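(* For each $c > 0$, \[ V_P(c) = V_G^1(c) - \log 2 + 1. \]
   Context: Definition of $V_P(c)$. Let $S = [0,1]^2$ be the unit square and let $\mathcal{M}$ be the set of copulas, i.e. Borel probability measures on $S$ both of whose marginals are the uniform measure on $[0,1]$. Let $u$ be Lebesgue measure on $S$ and let $D(\lambda \| u)$ be the Kullback–Leibler divergence of $\lambda$ with respect to $u$ (equal to $+\infty$ if $\lambda$ is not absolutely continuous with respect to $u$). For $c > 0$, $V_P(c)$ is the maximal value of the variational problem \[ \text{maximise} \quad -c \int_{S} |x-y| \, d\lambda(x,y) - D(\lambda \| u) \quad \text{over} \quad \lambda \in \mathcal{M}. \] Definition of $V_G^1(c)$. Let $C(\mathbb{R})$ be the space of continuous functions $\mathbb{R} \to \mathbb{R}$. Let $\mathcal{H} \subset C(\mathbb{R})$ be the reproducing kernel Hilbert space of the kernel $\kappa(s,t) = e^{-|s-t|}$ on $\mathbb{R}$, i.e. the completion of the space of finite linear combinations $\sum_i a_i \kappa(s_i,\cdot)$ under the inner product $\langle \sum_i a_i \kappa(s_i,\cdot), \sum_j a'_j \kappa(s'_j,\cdot)\rangle_{\mathcal{H}} = \sum_{i,j} a_i a'_j \kappa(s_i,s'_j)$, with norm $\|\cdot\|_{\mathcal{H}}$. For $f \in C(\mathbb{R})$ let $I[f] = \frac12 \|f\|_{\mathcal{H}}^2$ if $f \in \mathcal{H}$ and $I[f] = \infty$ otherwise. For $f_1,f_2 \in C(\mathbb{R})$ let $J_c[f_1,f_2] = \frac1c \int_0^c \log(f_1(s)^2 +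 f_2(s)^2)\, ds$ (with $\log 0 = -\infty$). Then $V_G^1(c)$ is the maximal value of $J_c[f_1,f_2] - I[f_1] - I[f_2]$ over $f_1,f_2 \in C(\mathbb{R})$. *)

theory Defs
  imports "HOL-Probability.Probability" "HOL-Library.Poly_Mapping"
begin

text \<open>
  Integral with values in the extended reals. It is meaningful if the positive or the negative
  part has a finite integral; this holds in both uses below (a relative entropy of probability
  measures, whose negative part is integrable, and the integral over a bounded interval of a
  function bounded above).
\<close>

definition ereal_integral :: "'a measure \<Rightarrow> ('a \<Rightarrow> ereal) \<Rightarrow> ereal" where
  "ereal_integral M f =
     enn2ereal (\<integral>\<^sup>+ x. e2ennreal (f x) \<partial>M) - enn2ereal (\<integral>\<^sup>+ x. e2ennreal (- f x) \<partial>M)"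


subsection \<open>The variational problem for copulas\<close>

abbreviation unit_square :: "(real \<times> real) set" where
  "unit_square \<equiv> {0..1} \<times> {0..1}"

definition leb_square :: "(real \<times> real) measure" where
  "leb_square = restrict_space lborel unit_square"

definition copulas :: "(real \<times> real) measure set" where
  "copulas = {M. prob_space M \<and> sets M = sets (restrict_space borel unit_square) \<and>
     distr M borel fst = uniform_measure lborel {0..1} \<and>
     distr M borel snd = uniform_measure lborel {0..1}}"

text \<open>
  \<open>KL_div M N\<close> is the divergence of \<open>M\<close> with respect to \<open>N\<close>. The constant \<^const>\<open>KL_divergence\<close> takes
  its arguments in the opposite order, is real-valued, and is \<open>0\<close> if the logarithmic density is
  not integrable; hence the extended integral of the same density.
\<close>

definition KL_div :: "'a measure \<Rightarrow> 'a measure \<Rightarrow> ereal" where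
  "KL_div M N =
     (if absolutely_continuous N M
      then ereal_integral M (\<lambda>x. ereal (entropy_density (exp 1) N M x)) else \<infinity>)"

definition P_objective :: "real \<Rightarrow> (real \<times> real) measure \<Rightarrow> ereal" where
  "P_objective c M = ereal (- c * (\<integral>(x, y). \<bar>x - y\<bar> \<partial>M)) - KL_div M leb_square"

definition V_P :: "real \<Rightarrow> ereal" where
  "V_P c = (SUP M\<in>copulas. P_objective c M)"


subsection \<open>Reproducing kernel Hilbert spaces\<close>

text \<open>
  A finitely supported \<open>a :: 'a \<Rightarrow>\<^sub>0 real\<close> encodes the linear combination of the functions \<open>k s\<close>
  with coefficients \<open>lookup a s\<close>.
\<close>

definition ker_comb :: "('a \<Rightarrow> 'a \<Rightarrow> real) \<Rightarrow> ('a \<Rightarrow>\<^sub>0 real) \<Rightarrow> 'a \<Rightarrow> real" where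
  "ker_comb k a t = (\<Sum>s\<in>Poly_Mapping.keys a. Poly_Mapping.lookup a s * k s t)"

definition ker_inner :: "('a \<Rightarrow> 'a \<Rightarrow> real) \<Rightarrow> ('a \<Rightarrow>\<^sub>0 real) \<Rightarrow> ('a \<Rightarrow>\<^sub>0 real) \<Rightarrow> real" where
  "ker_inner k a b = (\<Sum>s\<in>Poly_Mapping.keys a. \<Sum>t\<in>Poly_Mapping.keys b. Poly_Mapping.lookup a s * Poly_Mapping.lookup b t * k s t)"

definition ker_norm :: "('a \<Rightarrow> 'a \<Rightarrow> real) \<Rightarrow> ('a \<Rightarrow>\<^sub>0 real) \<Rightarrow> real" where
  "ker_norm k a = sqrt (ker_inner k a a)"

text \<open>
  The completion is realised as a space of functions: an element of it is a class of Cauchy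
  sequences of combinations, and is identified with their common pointwise limit. Pointwise
  limits exist, and determine the class, because evaluation at \<open>t\<close> is the inner product with \<open>k t\<close>.
\<close>

definition rkhs_represents :: "('a \<Rightarrow> 'a \<Rightarrow> real) \<Rightarrow> (nat \<Rightarrow> 'a \<Rightarrow>\<^sub>0 real) \<Rightarrow> ('a \<Rightarrow> real) \<Rightarrow> bool" where
  "rkhs_represents k A f \<longleftrightarrow>
     (\<forall>e>0. \<exists>N. \<forall>m\<ge>N. \<forall>n\<ge>N. ker_norm k (A m - A n) < e) \<and>
     (\<forall>t. (\<lambda>n. ker_comb k (A n) t) \<longlonglongrightarrow> f t)"

definition rkhs :: "('a \<Rightarrow> 'a \<Rightarrow> real) \<Rightarrow> ('a \<Rightarrow> real) set" where
  "rkhs k = {f. \<exists>A. rkhs_represents k A f}"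

definition rkhs_norm :: "('a \<Rightarrow> 'a \<Rightarrow> real) \<Rightarrow> ('a \<Rightarrow> real) \<Rightarrow> real" where
  "rkhs_norm k f = (THE r. \<exists>A. rkhs_represents k A f \<and> (\<lambda>n. ker_norm k (A n)) \<longlonglongrightarrow> r)"


subsection \<open>The variational problem for Gaussian processes\<close>

definition ou_kernel :: "real \<Rightarrow> real \<Rightarrow> real" where
  "ou_kernel s t = exp (- \<bar>s - t\<bar>)"

definition I_rate :: "(real \<Rightarrow> real) \<Rightarrow> ereal" where
  "I_rate f = (if f \<in> rkhs ou_kernel then ereal (1/2 * (rkhs_norm ou_kernel f)\<^sup>2) else \<infinity>)"

text \<open>The logarithm on \<open>[0,\<infinity>)\<close> with value \<open>-\<infinity>\<close> at \<open>0\<close>, where \<^const>\<open>ln\<close> has a finite value.\<close>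

definition ext_log :: "real \<Rightarrow> ereal" where
  "ext_log x = (if x > 0 then ereal (ln x) else -\<infinity>)"

definition J_func :: "real \<Rightarrow> (real \<Rightarrow> real) \<Rightarrow> (real \<Rightarrow> real) \<Rightarrow> ereal" where
  "J_func c f1 f2 =
     ereal (1 / c) *
     ereal_integral (restrict_space lborel {0..c}) (\<lambda>s. ext_log ((f1 s)\<^sup>2 + (f2 s)\<^sup>2))"

definition G_objective :: "real \<Rightarrow> (real \<Rightarrow> real) \<times> (real \<Rightarrow> real) \<Rightarrow> ereal" where
  "G_objective c = (\<lambda>(f1, f2). J_func c f1 f2 - I_rate f1 - I_rate f2)"

definition cont_fun_pairs :: "((real \<Rightarrow> real) \<times> (real \<Rightarrow> real)) set" where
  "cont_fun_pairs = {f. continuous_on UNIV f} \<times> {f. continuous_on UNIV f}"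

definition V_G1 :: "real \<Rightarrow> ereal" where
  "V_G1 c = (SUP f\<in>cont_fun_pairs. G_objective c f)"

end

theory Submission
  imports Defs "HOL-Real_Asymp.Real_Asymp"
begin

text \<open>
  Both problems are governed by the positive solution \<open>h\<close> of
  \<open>h x = (\<integral>y\<in>[0,1]. exp (- c * \<bar>x - y\<bar>) / h y)\<close>. It exists because the right-hand side is a contraction in
  Hilbert's projective metric. The copula with density \<open>exp (- c * \<bar>x - y\<bar>) / (h x * h y)\<close> is optimal by
  Gibbs' inequality, and its value is \<open>2 * (\<integral> ln h)\<close>.

  For the Gaussian problem, \<open>ln t \<le> ln (2 * h\<^sup>2) + t / (2 * h\<^sup>2) - 1\<close> reduces the upper bound
  \<open>ln 2 + 2 * (\<integral> ln h) - 1\<close> to the inequality \<open>(\<integral>x\<in>[0,1]. (f (c * x) / h x)\<^sup>2) \<le> \<parallel>f\<parallel>\<^sup>2\<close>. Since \<open>h\<close> is a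
  positive eigenfunction, with eigenvalue 1, of the kernel with respect to the measure with density
  \<open>1 / h\<^sup>2\<close>, this follows from Schur's test. The bound is attained at \<open>f\<^sub>1 = f\<^sub>2 = h (\<cdot> / c)\<close>, which has norm 1.
\<close>

subsection \<open>Positive kernels and Hilbert's projective metric\<close>

text \<open>The equation for \<open>h\<close> is the stationarity condition of both problems. For
  copulas, Lagrange multipliers for the two marginals suggest a density
  \<open>exp (- c * |x - y|) * a x * b y\<close>; by symmetry take \<open>a = b = 1 / h\<close>, and
  uniformity of the marginals becomes the equation. For the Gaussian problem, varying f1 gives f1 =
  (1/c) * integral over s in [0,c] of 2 f1(s) / (f1(s)^2 + f2(s)^2) * kappa(s, .); with f1 = f2 =
  h(./c) and s = c y this is the same equation. Stationarity alone does not settle the Gaussian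
  side, since log(f1^2 + f2^2) is not concave in the pair. The tangent of the logarithm at the
  stationary value 2 h^2 leaves a quadratic problem, and there the bound is global. The constants
  arise at the maximiser: f1^2 + f2^2 = 2 h^2 gives log 2, and two rates of 1/2 give 1. The map
  defining \<open>h\<close> inverts its argument, so it sends a scale s to 1/s, which is no
  contraction. The projective metric ignores scale; the scale is fixed at the end.\<close>

lemma (in prob_space) integral_pos:
  assumes "integrable M f" "\<And>y. y \<in> space M \<Longrightarrow> f y > (0::real)"
  shows "integral\<^sup>L M f > 0"
proof -
  have "integral\<^sup>L M f \<noteq> 0"
  proof
    assume "integral\<^sup>L M f = 0"
    then have "AE y in M. f y = 0"
      using integral_nonneg_eq_0_iff_AE[OF assms(1)] assms(2) by (simp add: AE_I2 less_imp_le)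
    with AE_space have "AE y in M. False"
    proof eventually_elim
      case (elim y) then show ?case using assms(2)[of y] by simp
    qed
    then show False by simp
  qed
  moreover have "integral\<^sup>L M f \<ge> 0" using assms(2) by (intro integral_nonneg_AE AE_I2 less_imp_le)
  ultimately show ?thesis by simp
qed

locale bounded_kernel = prob_space M for M :: "'a measure" +
  fixes k :: "'a \<Rightarrow> 'a \<Rightarrow> real" and \<delta> :: real
  assumes k_measurable [measurable]: "case_prod k \<in> borel_measurable (M \<Otimes>\<^sub>M M)"
    and \<delta>_pos: "\<delta> > 0"
    and k_lower: "\<And>x y. x \<in> space M \<Longrightarrow> y \<in> space M \<Longrightarrow> \<delta> \<le> k x y"
    and k_upper: "\<And>x y. x \<in> space M \<Longrightarrow> y \<in> space M \<Longrightarrow> k x y \<le> 1"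
begin

text \<open>The linear integral operator with kernel \<open>k\<close>, applied to
  \<open>1 / u\<close>. Inversion is an isometry of Hilbert's metric, so the composition contracts
  as the linear operator does.\<close>

definition T :: "('a \<Rightarrow> real) \<Rightarrow> 'a \<Rightarrow> real" where
  "T u x = (\<integral>y. k x y / u y \<partial>M)"

definition pos_bdd :: "('a \<Rightarrow> real) \<Rightarrow> bool" where
  "pos_bdd u \<longleftrightarrow> u \<in> borel_measurable M \<and> (\<exists>a>0. \<exists>b. \<forall>x\<in>space M. a \<le> u x \<and> u x \<le> b)"

lemma T_scale: "T (\<lambda>y. s * u y) x = T u x / s"
  unfolding T_def by (simp only: mult.commute[of s] divide_divide_eq_left[symmetric] integral_divide_zero)

lemma pos_bddD: "pos_bdd u \<Longrightarrow> u \<in> borel_measurable M"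
  "pos_bdd u \<Longrightarrow> x \<in> space M \<Longrightarrow> u x > 0"
  unfolding pos_bdd_def by force+

lemma \<delta>_le_1: "\<delta> \<le> 1"
  using not_empty k_lower k_upper by (metis ex_in_conv order_trans)

lemma k_pos: "x \<in> space M \<Longrightarrow> y \<in> space M \<Longrightarrow> k x y > 0"
  using k_lower \<delta>_pos by (meson less_le_trans)

lemma k_section [measurable]: "x \<in> space M \<Longrightarrow> k x \<in> borel_measurable M"
  by simp

lemma T_integrable:
  assumes "pos_bdd u" "x \<in> space M" shows "integrable M (\<lambda>y. k x y / u y)"
proof -
  obtain a b where ab: "a > 0" "\<And>y. y \<in> space M \<Longrightarrow> a \<le> u y \<and> u y \<le> b"
    using assms unfolding pos_bdd_def by blast
  note [measurable] = pos_bddD(1)[OF assms(1)] k_section[OF assms(2)]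
  show ?thesis
  proof (rule integrable_const_bound[of _ "1 / a"])
    show "AE y in M. norm (k x y / u y) \<le> 1 / a"
    proof (rule AE_I2)
      fix y assume y: "y \<in> space M"
      have "k x y / u y \<le> 1 / a"
        using ab y k_upper[OF assms(2) y] k_pos[OF assms(2) y] by (intro frac_le) auto
      then show "norm (k x y / u y) \<le> 1 / a"
        using ab(1) ab(2)[of y] y k_pos[OF assms(2) y] by auto
    qed
  qed measurable
qed

lemma T_pos:
  assumes "pos_bdd u" "x \<in> space M" shows "T u x > 0"
  unfolding T_def using T_integrable[OF assms] k_pos assms pos_bddD(2)[OF assms(1)]
  by (intro integral_pos) auto

text \<open>Any two sections \<open>k x\<close> and \<open>k z\<close> have ratio at least
  \<open>\<delta>\<close> pointwise, and integration preserves this. The constant does not depend on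
  \<open>u\<close>, so the range of \<open>T\<close> has bounded projective diameter.\<close>

lemma T_Harnack:
  assumes "pos_bdd u" "x \<in> space M" "z \<in> space M" shows "\<delta> * T u x \<le> T u z"
proof -
  have "\<delta> * T u x = (\<integral>y. \<delta> * (k x y / u y) \<partial>M)" unfolding T_def by (rule integral_mult_right_zero[symmetric])
  also have "\<dots> \<le> T u z" unfolding T_def
  proof (rule integral_mono)
    fix y assume y: "y \<in> space M"
    have "\<delta> * k x y \<le> \<delta> * 1" using k_upper[of x y] assms y \<delta>_pos by (intro mult_left_mono) auto
    also have "\<dots> \<le> k z y" using k_lower assms y by auto
    finally show "\<delta> * (k x y / u y) \<le> k z y / u y"
      using pos_bddD(2)[OF assms(1) y] by (simp add: divide_right_mono)
  qed (use T_integrable assms in \<open>auto intro: integrable_mult_right simp del: times_divide_eq_right\<close>)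
  finally show ?thesis .
qed

lemma pos_bdd_T:
  assumes "pos_bdd u" shows "pos_bdd (T u)"
proof -
  obtain x0 where x0: "x0 \<in> space M" using not_empty by blast
  note [measurable] = pos_bddD(1)[OF assms]
  have "T u \<in> borel_measurable M" unfolding T_def by measurable
  moreover have "\<delta> * T u x0 \<le> T u x \<and> T u x \<le> T u x0 / \<delta>" if "x \<in> space M" for x
    using T_Harnack[OF assms x0 that] T_Harnack[OF assms that x0] \<delta>_pos
    by (simp add: field_simps)
  ultimately show ?thesis unfolding pos_bdd_def
    using T_pos[OF assms x0] \<delta>_pos by (intro conjI exI[of _ "\<delta> * T u x0"] exI[of _ "T u x0 / \<delta>"]) auto
qed

text \<open>Birkhoff's contraction theorem. The densities \<open>k x y / v y / T v x\<close> for two points \<open>x\<close> dominate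
  \<open>\<delta>\<^sup>2\<close> times each other, so the averages of \<open>v / u\<close> they define are closer together than the values
  of \<open>v / u\<close>.\<close>

lemma T_contraction:
  assumes u: "pos_bdd u" and v: "pos_bdd v"
    and w: "\<And>y z. y \<in> space M \<Longrightarrow> z \<in> space M \<Longrightarrow> u y * v z \<le> exp w * (v y * u z)"
    and x: "x \<in> space M" and x': "x' \<in> space M"
  shows "T u x * T v x' \<le> exp ((1 - \<delta>\<^sup>2) * w) * (T v x * T u x')"
proof -
  define \<epsilon> where "\<epsilon> = \<delta>\<^sup>2"
  have \<epsilon>: "0 < \<epsilon>" "\<epsilon> \<le> 1" using \<delta>_pos \<delta>_le_1 by (auto simp: \<epsilon>_def power_le_one)
  define X where "X = T u x / T v x"
  have pos: "T u x > 0" "T v x > 0" "T u x' > 0" "T v x' > 0" using T_pos u v x x' by auto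
  then have X: "X > 0" by (simp add: X_def)
  \<comment> \<open>\<open>X\<close> is an average of \<open>v / u\<close>, hence exceeds each
    single value by at most the factor \<open>exp w\<close>.\<close>
  have g: "exp (-w) * X \<le> v z / u z" if z: "z \<in> space M" for z
  proof -
    have "T u x \<le> (\<integral>y. exp w * (v z / u z) * (k x y / v y) \<partial>M)" unfolding T_def
    proof (rule integral_mono)
      fix y assume y: "y \<in> space M"
      have p: "u y > 0" "v y > 0" "u z > 0" "v z > 0" "k x y > 0"
        using pos_bddD(2) u v y z k_pos x by auto
      have "1 / u y \<le> exp w * (v z / u z) * (1 / v y)"
        using w[OF z y] p by (simp add: field_simps)
      from mult_left_mono[OF this, of "k x y"] p
      show "k x y / u y \<le> exp w * (v z / u z) * (k x y / v y)" by (simp add: mult_ac)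
    qed (use T_integrable u v x in \<open>auto intro: integrable_mult_right simp del: times_divide_eq_right\<close>)
    also have "\<dots> = exp w * (v z / u z) * T v x" unfolding T_def by (rule integral_mult_right_zero)
    finally have "X \<le> exp w * (v z / u z)" using pos by (simp add: X_def field_simps)
    from mult_left_mono[OF this, of "exp (-w)"] show ?thesis
      by (simp add: mult.assoc[symmetric] exp_add[symmetric] del: mult.assoc)
  qed
  \<comment> \<open>One factor \<open>\<delta>\<close> is spent on the kernel and one on the
    normalising integral; this makes \<open>r\<close> nonnegative and explains
    \<open>\<delta>\<^sup>2\<close>.\<close>
  define r where "r y = k x' y / v y / T v x' - \<epsilon> * (k x y / v y / T v x)" for y
  have r_nonneg: "r y \<ge> 0" if y: "y \<in> space M" for y
  proof -
    have p: "v y > 0" using pos_bddD(2) v y by auto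
    have "\<delta> * T v x' \<le> T v x" using T_Harnack[OF v x' x] .
    moreover have "\<delta> * k x y \<le> k x' y"
      using k_upper[OF x y] k_lower[OF x' y] \<delta>_pos by (meson dual_order.trans less_imp_le mult_left_le)
    ultimately have "(\<delta> * T v x') * (\<delta> * k x y) \<le> T v x * k x' y"
      using pos k_pos[OF x y] \<delta>_pos by (intro mult_mono) auto
    then have "\<epsilon> * (k x y / T v x) \<le> k x' y / T v x'"
      using pos by (simp add: \<epsilon>_def field_simps power2_eq_square)
    from divide_right_mono[OF this, of "v y"] p show ?thesis by (simp add: r_def field_simps)
  qed
  have int: "integrable M (\<lambda>y. k z y / v y / C)" "integrable M (\<lambda>y. k z y / u y / C)"
    if "z \<in> space M" for z C
    using T_integrable[OF v that] T_integrable[OF u that] by (auto intro!: integrable_divide simp del: divide_divide_eq_left)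
  have T_eq: "(\<integral>y. k z y / v y / C \<partial>M) = T v z / C" "(\<integral>y. k z y / u y / C \<partial>M) = T u z / C" for z C
    by (simp_all only: T_def integral_divide_zero)
  have rint: "integrable M r" unfolding r_def
    by (intro Bochner_Integration.integrable_diff integrable_mult_right int x x')
  have rtot: "(\<integral>y. r y \<partial>M) = 1 - \<epsilon>"
    unfolding r_def
    by (subst Bochner_Integration.integral_diff)
      (use pos in \<open>simp_all add: int x x' integrable_mult_right T_eq T_def[symmetric] del: divide_divide_eq_left times_divide_eq_right\<close>)
  have rv: "r y * (v y / u y) = k x' y / u y / T v x' - \<epsilon> * (k x y / u y / T v x)"
    if "y \<in> space M" for y
    using pos_bddD(2)[OF u that] pos_bddD(2)[OF v that] pos by (simp add: r_def field_simps)
  \<comment> \<open>The lossy bound \<open>g\<close> is applied only to the remainder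
    \<open>r\<close> of mass \<open>1 - \<epsilon>\<close>; the common part of mass
    \<open>\<epsilon>\<close> contributes \<open>X\<close> without loss.\<close>
  have "(1 - \<epsilon>) * (exp (-w) * X) = (\<integral>y. r y * (exp (-w) * X) \<partial>M)" using rtot by simp
  also have "\<dots> \<le> (\<integral>y. k x' y / u y / T v x' - \<epsilon> * (k x y / u y / T v x) \<partial>M)"
  proof (rule integral_mono)
    fix y assume y: "y \<in> space M"
    show "r y * (exp (- w) * X) \<le> k x' y / u y / T v x' - \<epsilon> * (k x y / u y / T v x)"
      unfolding rv[OF y, symmetric] using g[OF y] r_nonneg[OF y] by (rule mult_left_mono)
  qed (intro Bochner_Integration.integrable_diff integrable_mult_right integrable_mult_left int rint x x')+
  also have "\<dots> = T u x' / T v x' - \<epsilon> * X"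
    by (subst Bochner_Integration.integral_diff)
      (simp_all add: int x x' integrable_mult_right T_eq T_def[symmetric] X_def del: divide_divide_eq_left times_divide_eq_right)
  finally have 1: "X * (\<epsilon> + (1 - \<epsilon>) * exp (-w)) \<le> T u x' / T v x'" by (simp add: algebra_simps)
  \<comment> \<open>Convexity turns the weighted mean of 1 and \<open>exp (-w)\<close> into a single
    exponential, so that the distance shrinks by the factor \<open>1 - \<epsilon>\<close>.\<close>
  have "exp ((1 - (1 - \<epsilon>)) *\<^sub>R 0 + (1 - \<epsilon>) *\<^sub>R (-w)) \<le> (1 - (1 - \<epsilon>)) * exp 0 + (1 - \<epsilon>) * exp (-w)"
    using \<epsilon> by (intro convex_onD[OF exp_convex]) auto
  then have "exp (- ((1 - \<epsilon>) * w)) \<le> \<epsilon> + (1 - \<epsilon>) * exp (-w)" by simp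
  with 1 X have "X * exp (- ((1 - \<epsilon>) * w)) \<le> T u x' / T v x'"
    by (meson dual_order.trans less_imp_le mult_left_mono)
  moreover define e where "e = exp ((1 - \<epsilon>) * w)"
  ultimately have "X / e \<le> T u x' / T v x'" by (simp add: exp_minus divide_inverse)
  moreover have "e > 0" by (simp add: e_def)
  ultimately show ?thesis
    unfolding \<epsilon>_def[symmetric] e_def[symmetric] using pos by (simp add: X_def field_simps)
qed

text \<open>Only the directions of the iterates of \<open>T\<close> are controlled, so they are
  normalised at a point \<open>x0\<close>. Their logarithms then have geometrically small
  increments; the limit is an eigenfunction, and a rescaling removes the eigenvalue.\<close>

lemma exists_fixed_point: "\<exists>h. pos_bdd h \<and> (\<forall>x\<in>space M. h x = T h x)"
proof -
  obtain x0 where x0: "x0 \<in> space M" using not_empty by blast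
  define U where "U n = (T ^^ n) (\<lambda>_. 1)" for n
  have U_Suc: "U (Suc n) = T (U n)" for n by (simp add: U_def)
  have U: "pos_bdd (U n)" for n
  proof (induction n)
    case 0 then show ?case by (auto simp: U_def pos_bdd_def intro!: exI[of _ "1::real"])
  qed (simp add: U_Suc pos_bdd_T)
  have Upos: "x \<in> space M \<Longrightarrow> U n x > 0" for n x using pos_bddD(2)[OF U] .
  have U_Harnack: "\<delta> * U n x \<le> U n z" if "x \<in> space M" "z \<in> space M" for n x z
  proof (cases n)
    case 0 then show ?thesis using \<delta>_le_1 by (simp add: U_def)
  next
    case (Suc m) then show ?thesis using T_Harnack[OF U that] by (simp add: U_Suc)
  qed
  define \<kappa> where "\<kappa> = 1 - \<delta>\<^sup>2"
  have \<kappa>: "0 \<le> \<kappa>" "\<kappa> < 1" using \<delta>_pos \<delta>_le_1 by (auto simp: \<kappa>_def power_le_one)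
  \<comment> \<open>The initial distance: the values of \<open>U 0\<close> and of \<open>U 1\<close>
    each vary by a factor of at most \<open>1 / \<delta>\<close>.\<close>
  define w where "w = - ln (\<delta>\<^sup>2)"
  have osc: "U (Suc n) y * U n z \<le> exp (\<kappa> ^ n * w) * (U n y * U (Suc n) z)"
    if "y \<in> space M" "z \<in> space M" for n y z using that
  proof (induction n arbitrary: y z)
    case 0
    have "\<delta> * U 1 y \<le> U 1 z" "\<delta> * U 0 z \<le> U 0 y" using U_Harnack 0 by auto
    then have "(\<delta> * U 1 y) * (\<delta> * U 0 z) \<le> U 1 z * U 0 y"
      using Upos[OF 0(1)] Upos[OF 0(2)] \<delta>_pos by (intro mult_mono) (auto simp: less_imp_le)
    then show ?case using \<delta>_pos by (simp add: w_def exp_minus field_simps power2_eq_square)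
  next
    case (Suc n)
    then show ?case using T_contraction[OF U[of "Suc n"] U[of n] Suc.IH Suc.prems]
      by (simp add: U_Suc \<kappa>_def[symmetric] mult_ac)
  qed
  define \<phi> where "\<phi> n x = U n x / U n x0" for n x
  have \<phi>_bd: "\<delta> \<le> \<phi> n x" "\<phi> n x \<le> 1 / \<delta>" if "x \<in> space M" for n x
    using U_Harnack[OF that x0, of n] U_Harnack[OF x0 that, of n] Upos[OF x0, of n] \<delta>_pos
    by (simp_all add: \<phi>_def field_simps)
  have \<phi>_pos: "x \<in> space M \<Longrightarrow> \<phi> n x > 0" for n x using \<phi>_bd \<delta>_pos by (meson less_le_trans)
  have step: "\<bar>ln (\<phi> (Suc n) x) - ln (\<phi> n x)\<bar> \<le> \<kappa> ^ n * w" if x: "x \<in> space M" for n x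
  proof -
    have p: "U n x > 0" "U (Suc n) x > 0" "U n x0 > 0" "U (Suc n) x0 > 0"
      using Upos x x0 by auto
    have "ln (U (Suc n) y * U n z) \<le> ln (exp (\<kappa> ^ n * w) * (U n y * U (Suc n) z))"
      if "y \<in> space M" "z \<in> space M" for y z
      using osc[OF that] Upos[OF that(1)] Upos[OF that(2)] by (subst ln_le_cancel_iff) auto
    from this[OF x x0] this[OF x0 x] show ?thesis
      using p by (simp add: ln_mult \<phi>_def ln_div)
  qed
  have "convergent (\<lambda>n. ln (\<phi> n x))" if "x \<in> space M" for x
  proof -
    have "summable (\<lambda>n. ln (\<phi> (Suc n) x) - ln (\<phi> n x))"
    proof (rule summable_comparison_test'[of "\<lambda>n. \<kappa> ^ n * w" 0])
      show "summable (\<lambda>n. \<kappa> ^ n * w)" using \<kappa> by (intro summable_mult2 summable_geometric) simp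
    qed (use step[OF that] in simp)
    then have "convergent (\<lambda>n. ln (\<phi> n x) - ln (\<phi> 0 x))"
      unfolding summable_iff_convergent sum_lessThan_telescope[of "\<lambda>n. ln (\<phi> n x)"] .
    from convergent_add[OF this convergent_const[of "ln (\<phi> 0 x)"]] show ?thesis by simp
  qed
  then have conv: "(\<lambda>n. ln (\<phi> n x)) \<longlonglongrightarrow> lim (\<lambda>n. ln (\<phi> n x))" if "x \<in> space M" for x
    using that by (simp only: convergent_LIMSEQ_iff)
  define f where "f x = exp (lim (\<lambda>n. ln (\<phi> n x)))" for x
  have lim_f: "(\<lambda>n. \<phi> n x) \<longlonglongrightarrow> f x" if "x \<in> space M" for x
    using tendsto_exp[OF conv[OF that]] \<phi>_pos[OF that] by (simp add: f_def)
  have f_bd: "\<delta> \<le> f x" "f x \<le> 1 / \<delta>" if "x \<in> space M" for x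
    using \<phi>_bd[OF that] by (auto intro: LIMSEQ_le_const[OF lim_f[OF that]] LIMSEQ_le_const2[OF lim_f[OF that]])
  note [measurable] = pos_bddD(1)[OF U]
  have [measurable]: "\<phi> n \<in> borel_measurable M" for n unfolding \<phi>_def by measurable
  have [measurable]: "f \<in> borel_measurable M"
    using lim_f by (rule borel_measurable_LIMSEQ_real) auto
  have f: "pos_bdd f" unfolding pos_bdd_def using f_bd \<delta>_pos by auto
  have lim_T: "(\<lambda>n. T (\<phi> n) x) \<longlonglongrightarrow> T f x" if x: "x \<in> space M" for x
    unfolding T_def
  proof (rule integral_dominated_convergence[where w = "\<lambda>_. 1 / \<delta>"])
    show "AE y in M. norm (k x y / \<phi> n y) \<le> 1 / \<delta>" for n
    proof (rule AE_I2)
      fix y assume y: "y \<in> space M"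
      have "k x y / \<phi> n y \<le> 1 / \<delta>"
        using \<phi>_bd[OF y] k_upper[OF x y] k_pos[OF x y] \<delta>_pos by (intro frac_le) auto
      then show "norm (k x y / \<phi> n y) \<le> 1 / \<delta>" using k_pos[OF x y] \<phi>_pos[OF y, of n] by simp
    qed
    show "AE y in M. (\<lambda>n. k x y / \<phi> n y) \<longlonglongrightarrow> k x y / f y"
      using lim_f f_bd \<delta>_pos by (intro AE_I2 tendsto_divide) force+
  qed (use x in auto)
  define s where "s n = T (\<phi> n) x0" for n
  \<comment> \<open>Normalising costs the factor \<open>s n\<close>. It converges to
    \<open>T f x0\<close>, which becomes the eigenvalue.\<close>
  have T\<phi>: "T (\<phi> n) x = s n * \<phi> (Suc n) x" if x: "x \<in> space M" for n x
  proof -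
    have "T (\<phi> n) z = U n x0 * U (Suc n) z" for z
      using T_scale[of "1 / U n x0" "U n" z] by (simp add: \<phi>_def[abs_def] U_Suc)
    then show ?thesis using Upos[OF x0, of "Suc n"] by (simp add: s_def \<phi>_def)
  qed
  have eigen: "T f x = T f x0 * f x" if x: "x \<in> space M" for x
  proof (rule LIMSEQ_unique[OF lim_T[OF x]])
    show "(\<lambda>n. T (\<phi> n) x) \<longlonglongrightarrow> T f x0 * f x"
      unfolding T\<phi>[OF x] s_def by (intro tendsto_mult lim_T x0 LIMSEQ_Suc[OF lim_f[OF x]])
  qed
  define l where "l = T f x0"
  have l: "l > 0" using T_pos[OF f x0] by (simp add: l_def)
  \<comment> \<open>By degree -1, \<open>T\<close> divides by \<open>sqrt l\<close>, and
    \<open>l / sqrt l = sqrt l\<close>.\<close>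
  define h where "h x = sqrt l * f x" for x
  have "h x = T h x" if "x \<in> space M" for x
  proof -
    have "T h x = l / sqrt l * f x"
      by (simp add: h_def[abs_def] T_scale eigen[OF that] l_def[symmetric])
    then show ?thesis using l by (simp only: h_def real_div_sqrt less_imp_le)
  qed
  moreover have "pos_bdd h" unfolding pos_bdd_def
  proof (intro conjI exI ballI)
    show "h \<in> borel_measurable M" unfolding h_def by measurable
    show "sqrt l * \<delta> > 0" using l \<delta>_pos by simp
    show "sqrt l * \<delta> \<le> h x" "h x \<le> sqrt l * (1 / \<delta>)" if "x \<in> space M" for x
      using f_bd[OF that] l by (auto simp: h_def intro!: mult_left_mono simp del: mult_1_right times_divide_eq_right)
  qed
  ultimately show ?thesis by blast
qed

end

subsection \<open>Reproducing kernel Hilbert spaces\<close>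

text \<open>The integral of \<open>g\<close> against the finitely supported signed measure
  \<open>a\<close>. Evaluation of combinations and their inner product are both instances, and
  bilinearity follows from linearity here.\<close>

definition pairing :: "('a \<Rightarrow>\<^sub>0 real) \<Rightarrow> ('a \<Rightarrow> real) \<Rightarrow> real" where
  "pairing a g = (\<Sum>s\<in>Poly_Mapping.keys a. Poly_Mapping.lookup a s * g s)"

lemma pairing_superset:
  assumes "finite S" "Poly_Mapping.keys a \<subseteq> S"
  shows "pairing a g = (\<Sum>s\<in>S. Poly_Mapping.lookup a s * g s)"
  unfolding pairing_def using assms by (intro sum.mono_neutral_left) (auto simp: in_keys_iff)

lemma pairing_add: "pairing (a + b) g = pairing a g + pairing b g"
proof -
  let ?S = "Poly_Mapping.keys a \<union> Poly_Mapping.keys b"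
  show ?thesis
    using Poly_Mapping.keys_add[of a b]
    by (simp add: pairing_superset[of ?S] lookup_add distrib_right sum.distrib)
qed

lemma pairing_diff: "pairing (a - b) g = pairing a g - pairing b g"
  using pairing_add[of "a - b" b g] by simp

lemma pairing_single [simp]: "pairing (Poly_Mapping.single s v) g = v * g s"
  by (simp add: pairing_def)

lemma pairing_zero [simp]: "pairing 0 g = 0"
  by (simp add: pairing_def)

lemma pairing_sum: "pairing (\<Sum>i\<in>I. F i) g = (\<Sum>i\<in>I. pairing (F i) g)"
  by (induction I rule: infinite_finite_induct) (simp_all add: pairing_add)

lemma pairing_scale: "pairing (Poly_Mapping.map ((*) r) a) g = r * pairing a g"
proof -
  have "Poly_Mapping.keys (Poly_Mapping.map ((*) r) a) \<subseteq> Poly_Mapping.keys a"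
    by (auto simp: in_keys_iff map.rep_eq)
  then have "pairing (Poly_Mapping.map ((*) r) a) g = (\<Sum>s\<in>Poly_Mapping.keys a. r * Poly_Mapping.lookup a s * g s)"
    by (subst pairing_superset[of "Poly_Mapping.keys a"]) (auto simp: map.rep_eq when_def intro!: sum.cong)
  then show ?thesis by (simp add: pairing_def sum_distrib_left mult.assoc)
qed

lemma pairing_linear:
  "pairing a (\<lambda>s. f s + g s) = pairing a f + pairing a g"
  "pairing a (\<lambda>s. f s - g s) = pairing a f - pairing a g"
  "pairing a (\<lambda>s. r * f s) = r * pairing a f"
  by (simp_all add: pairing_def algebra_simps sum.distrib sum_subtractf sum_distrib_left)

lemma pairing_tendsto: "(\<And>s. (\<lambda>n. g n s) \<longlonglongrightarrow> f s) \<Longrightarrow> (\<lambda>n. pairing a (g n)) \<longlonglongrightarrow> pairing a f"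
  unfolding pairing_def by (intro tendsto_intros)

lemma ker_comb_pairing: "ker_comb k a t = pairing a (\<lambda>s. k s t)"
  by (simp add: ker_comb_def pairing_def)

lemma ker_inner_pairing: "ker_inner k a b = pairing a (\<lambda>s. pairing b (k s))"
  by (simp add: ker_inner_def pairing_def sum_distrib_left mult_ac)

locale psd_kernel =
  fixes k :: "'a \<Rightarrow> 'a \<Rightarrow> real"
  assumes k_sym: "k s t = k t s"
    and k_psd: "ker_inner k a a \<ge> 0"
begin

lemma inner_comb: "ker_inner k a b = pairing a (ker_comb k b)"
  unfolding ker_inner_pairing ker_comb_pairing[abs_def] by (subst k_sym) (rule refl)

lemma inner_linear:
  "ker_inner k (a + a') b = ker_inner k a b + ker_inner k a' b"
  "ker_inner k (a - a') b = ker_inner k a b - ker_inner k a' b"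
  "ker_inner k a (b + b') = ker_inner k a b + ker_inner k a b'"
  "ker_inner k a (b - b') = ker_inner k a b - ker_inner k a b'"
  "ker_inner k (Poly_Mapping.map ((*) r) a) b = r * ker_inner k a b"
  "ker_inner k a (Poly_Mapping.map ((*) r) b) = r * ker_inner k a b"
  by (simp_all add: ker_inner_pairing pairing_add pairing_diff pairing_scale pairing_linear)

lemma inner_commute: "ker_inner k a b = ker_inner k b a"
  unfolding ker_inner_def by (subst sum.swap) (simp add: mult_ac k_sym)

lemma norm_nonneg [simp]: "ker_norm k a \<ge> 0"
  by (simp add: ker_norm_def k_psd)

lemma norm_square: "(ker_norm k a)\<^sup>2 = ker_inner k a a"
  by (simp add: ker_norm_def k_psd)

lemma Cauchy_Schwarz: "\<bar>ker_inner k a b\<bar> \<le> ker_norm k a * ker_norm k b"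
proof -
  define A B C where "A = ker_inner k a a" and "B = ker_inner k b b" and "C = ker_inner k a b"
  have quad: "0 \<le> A - 2 * r * C + r\<^sup>2 * B" for r
    using k_psd[of "a - Poly_Mapping.map ((*) r) b"]
    by (simp add: inner_linear A_def B_def C_def inner_commute[of b a] power2_eq_square algebra_simps)
  have A: "A \<ge> 0" "B \<ge> 0" by (auto simp: A_def B_def k_psd)
  have "C\<^sup>2 \<le> A * B"
  proof (cases "B = 0")
    case True
    have "C = 0"
    proof (rule ccontr)
      assume "C \<noteq> 0"
      \<comment> \<open>For \<open>B = 0\<close> the quadratic is affine in \<open>r\<close>, and it
        takes the value -1 at this point.\<close>
      with quad[of "(A + 1) / (2 * C)"] True show False by simp
    qed
    then show ?thesis using True by simp
  next
    case False
    with A quad[of "C / B"] show ?thesis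
      by (simp add: field_simps power2_eq_square)
  qed
  then have "\<bar>C\<bar> \<le> sqrt (A * B)" by (simp add: real_le_rsqrt)
  then show ?thesis by (simp add: ker_norm_def A_def B_def C_def real_sqrt_mult)
qed

lemma norm_triangle: "ker_norm k (a + b) \<le> ker_norm k a + ker_norm k b"
proof (rule power2_le_imp_le)
  have "(ker_norm k (a + b))\<^sup>2 = (ker_norm k a)\<^sup>2 + 2 * ker_inner k a b + (ker_norm k b)\<^sup>2"
    by (simp add: norm_square inner_linear inner_commute[of b a])
  also have "\<dots> \<le> (ker_norm k a + ker_norm k b)\<^sup>2"
    using Cauchy_Schwarz[of a b] by (simp add: power2_sum)
  finally show "(ker_norm k (a + b))\<^sup>2 \<le> (ker_norm k a + ker_norm k b)\<^sup>2" .
qed simp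

lemma norm_minus: "ker_norm k (a - b) = ker_norm k (b - a)"
  by (simp add: ker_norm_def inner_linear inner_commute[of b a])

lemma norm_diff_ge: "\<bar>ker_norm k a - ker_norm k b\<bar> \<le> ker_norm k (a - b)"
  using norm_triangle[of "a - b" b] norm_triangle[of "b - a" a] norm_minus[of a b] by simp

text \<open>Reproducing property: evaluation at \<open>t\<close> is the inner product with the
  kernel function at \<open>t\<close>.\<close>

lemma comb_le: "\<bar>ker_comb k a t\<bar> \<le> ker_norm k a * sqrt (k t t)"
  using Cauchy_Schwarz[of a "Poly_Mapping.single t 1"]
  by (simp add: ker_inner_pairing ker_norm_def ker_comb_pairing)

lemma represents_norm_convergent:
  assumes "rkhs_represents k A f" shows "convergent (\<lambda>n. ker_norm k (A n))"
proof -
  have "Cauchy (\<lambda>n. ker_norm k (A n))"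
  proof (rule metric_CauchyI)
    fix e :: real assume "e > 0"
    then obtain N where "\<forall>m\<ge>N. \<forall>n\<ge>N. ker_norm k (A m - A n) < e"
      using assms unfolding rkhs_represents_def by blast
    then show "\<exists>N. \<forall>m\<ge>N. \<forall>n\<ge>N. dist (ker_norm k (A m)) (ker_norm k (A n)) < e"
      using norm_diff_ge unfolding dist_real_def by (meson le_less_trans)
  qed
  then show ?thesis by (simp add: Cauchy_convergent_iff)
qed

lemma represents_diff:
  assumes "rkhs_represents k A f" "rkhs_represents k B g"
  shows "rkhs_represents k (\<lambda>n. A n - B n) (\<lambda>t. f t - g t)"
  unfolding rkhs_represents_def
proof (intro conjI allI impI)
  fix e :: real assume "e > 0"
  then have "e / 2 > 0" by simp
  then obtain N N' where N: "\<forall>m\<ge>N. \<forall>n\<ge>N. ker_norm k (A m - A n) < e / 2"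
      "\<forall>m\<ge>N'. \<forall>n\<ge>N'. ker_norm k (B m - B n) < e / 2"
    using assms unfolding rkhs_represents_def by meson
  show "\<exists>N. \<forall>m\<ge>N. \<forall>n\<ge>N. ker_norm k (A m - B m - (A n - B n)) < e"
  proof (intro exI[of _ "max N N'"] allI impI)
    fix m n assume "m \<ge> max N N'" "n \<ge> max N N'"
    then have "ker_norm k (A m - A n) < e / 2" "ker_norm k (B n - B m) < e / 2" using N by auto
    moreover have "ker_norm k (A m - B m - (A n - B n)) \<le> ker_norm k (A m - A n) + ker_norm k (B n - B m)"
      using norm_triangle[of "A m - A n" "B n - B m"] by (simp add: algebra_simps)
    ultimately show "ker_norm k (A m - B m - (A n - B n)) < e" by simp
  qed
next
  fix t show "(\<lambda>n. ker_comb k (A n - B n) t) \<longlonglongrightarrow> f t - g t"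
    using assms unfolding rkhs_represents_def ker_comb_pairing pairing_diff by (intro tendsto_diff) auto
qed

text \<open>Split the squared norm of \<open>C n\<close> into its inner products with
  \<open>C m\<close> and with \<open>C n - C m\<close>. For fixed \<open>n\<close> the first tends
  to 0 in \<open>m\<close>, as it involves only finitely many point values of \<open>C m\<close>;
  the second is small by the Cauchy property.\<close>

lemma represents_zero:
  assumes C: "rkhs_represents k C (\<lambda>_. 0)" shows "(\<lambda>n. ker_norm k (C n)) \<longlonglongrightarrow> 0"
proof -
  obtain L where L: "(\<lambda>n. ker_norm k (C n)) \<longlonglongrightarrow> L"
    using represents_norm_convergent[OF C] by (auto simp: convergent_def)
  then have "Bseq (\<lambda>n. ker_norm k (C n))" using convergent_def convergent_imp_Bseq by blast
  then obtain K where K: "K > 0" "\<And>n. ker_norm k (C n) \<le> K" by (auto simp: Bseq_def)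
  have "L\<^sup>2 \<le> 0 + e" if "e > 0" for e
  proof -
    have "e / K > 0" using that K by simp
    then obtain N where N: "\<And>m n. m \<ge> N \<Longrightarrow> n \<ge> N \<Longrightarrow> ker_norm k (C m - C n) < e / K"
      using C unfolding rkhs_represents_def by blast
    have "(ker_norm k (C n))\<^sup>2 \<le> e" if n: "n \<ge> N" for n
    proof (rule LIMSEQ_le_const)
      show "(\<lambda>m. ker_inner k (C n) (C m) + e) \<longlonglongrightarrow> e"
      proof -
        have "(\<lambda>m. pairing (C n) (ker_comb k (C m))) \<longlonglongrightarrow> pairing (C n) (\<lambda>_. 0)"
          using C unfolding rkhs_represents_def by (intro pairing_tendsto) auto
        then have "(\<lambda>m. ker_inner k (C n) (C m)) \<longlonglongrightarrow> 0" by (simp add: inner_comb pairing_def)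
        from tendsto_add[OF this tendsto_const[of e]] show ?thesis by simp
      qed
      show "\<exists>N. \<forall>m\<ge>N. (ker_norm k (C n))\<^sup>2 \<le> ker_inner k (C n) (C m) + e"
      proof (intro exI[of _ N] allI impI)
        fix m assume m: "m \<ge> N"
        have "ker_inner k (C n) (C n - C m) \<le> ker_norm k (C n) * ker_norm k (C n - C m)"
          using Cauchy_Schwarz by (meson abs_le_D1)
        also have "\<dots> \<le> K * (e / K)"
          using N[OF n m] K by (intro mult_mono) auto
        finally show "(ker_norm k (C n))\<^sup>2 \<le> ker_inner k (C n) (C m) + e"
          using K by (simp add: norm_square inner_linear)
      qed
    qed
    then have "L\<^sup>2 \<le> e" by (intro LIMSEQ_le_const2[OF tendsto_power[OF L, of 2]]) auto
    then show ?thesis by simp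
  qed
  then have "L\<^sup>2 \<le> 0" by (rule field_le_epsilon)
  then show ?thesis using L by simp
qed

text \<open>This justifies the definite description in \<open>rkhs_norm\<close>: the difference of
  two representing sequences represents 0, so their norms have the same limit.\<close>

lemma rkhs_norm_tendsto:
  assumes A: "rkhs_represents k A f" shows "(\<lambda>n. ker_norm k (A n)) \<longlonglongrightarrow> rkhs_norm k f"
proof -
  obtain r where r: "(\<lambda>n. ker_norm k (A n)) \<longlonglongrightarrow> r"
    using represents_norm_convergent[OF A] by (auto simp: convergent_def)
  have "r' = r" if B: "rkhs_represents k B f" "(\<lambda>n. ker_norm k (B n)) \<longlonglongrightarrow> r'" for B r'
  proof -
    have "(\<lambda>n. ker_norm k (B n - A n)) \<longlonglongrightarrow> 0"
      using represents_diff[OF B(1) A] by (intro represents_zero) simp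
    then have "(\<lambda>n. ker_norm k (B n) - ker_norm k (A n)) \<longlonglongrightarrow> 0"
      by (rule Lim_null_comparison[rotated]) (simp add: norm_diff_ge)
    with tendsto_diff[OF B(2) r] show ?thesis using LIMSEQ_unique by fastforce
  qed
  then have "rkhs_norm k f = r" unfolding rkhs_norm_def using A r by (intro the_equality) blast+
  with r show ?thesis by simp
qed

end

subsection \<open>The Ornstein--Uhlenbeck kernel\<close>

lemma exp_neg_Lipschitz:
  fixes a b :: real assumes "a \<ge> 0" "b \<ge> 0" shows "\<bar>exp (-a) - exp (-b)\<bar> \<le> \<bar>a - b\<bar>"
proof -
  have *: "exp (-a) - exp (-b) \<le> b - a" if "0 \<le> a" "a \<le> b" for a b :: real
  proof -
    have "exp (-a) - exp (-b) = exp (-a) * (1 - exp (-(b - a)))" by (simp add: algebra_simps flip: exp_add)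
    also have "\<dots> \<le> 1 * (1 - exp (-(b - a)))" using that by (intro mult_right_mono) auto
    also have "\<dots> \<le> b - a" using exp_ge_add_one_self[of "a - b"] by (simp del: exp_ge_add_one_self)
    finally show ?thesis .
  qed
  show ?thesis
  proof (cases "a \<le> b")
    case True then show ?thesis using *[of a b] assms by simp
  next
    case False then show ?thesis using *[of b a] assms by simp
  qed
qed

lemma ou_kernel_Lipschitz: "\<bar>ou_kernel s t - ou_kernel s' t'\<bar> \<le> \<bar>s - s'\<bar> + \<bar>t - t'\<bar>"
proof -
  have "\<bar>ou_kernel s t - ou_kernel s' t'\<bar> \<le> \<bar>\<bar>s - t\<bar> - \<bar>s' - t'\<bar>\<bar>"
    unfolding ou_kernel_def by (rule exp_neg_Lipschitz) auto
  also have "\<dots> \<le> \<bar>s - s'\<bar> + \<bar>t - t'\<bar>" by arith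
  finally show ?thesis .
qed

lemma ou_kernel_pos [simp]: "ou_kernel s t > 0"
  and ou_kernel_le_1: "ou_kernel s t \<le> 1"
  and ou_kernel_refl [simp]: "ou_kernel t t = 1"
  and ou_kernel_commute: "ou_kernel s t = ou_kernel t s"
  by (simp_all add: ou_kernel_def abs_minus_commute)

lemma abs_ou_kernel_le_1: "\<bar>ou_kernel s t\<bar> \<le> 1"
  by (simp add: ou_kernel_def)

lemma continuous_on_ou_kernel [continuous_intros]:
  "continuous_on S f \<Longrightarrow> continuous_on S g \<Longrightarrow> continuous_on S (\<lambda>x. ou_kernel (f x) (g x))"
  unfolding ou_kernel_def by (intro continuous_intros)

lemma ou_kernel_measurable [measurable]:
  "f \<in> borel_measurable M \<Longrightarrow> g \<in> borel_measurable M \<Longrightarrow> (\<lambda>x. ou_kernel (f x) (g x)) \<in> borel_measurable M"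
  unfolding ou_kernel_def by measurable

text \<open>The one-sided exponential of the moving-average representation of the Ornstein-Uhlenbeck
  process, with time reversed so that products live on a half-line \<open>{a..}\<close>. Writing the
  kernel as an inner product of features makes its quadratic form the integral of a square.\<close>

definition ou_feature :: "real \<Rightarrow> real \<Rightarrow> real" where
  "ou_feature s u = sqrt 2 * exp (- s - u) * indicator {- s..} u"

lemma has_bochner_integral_ou_feature:
  "has_bochner_integral lborel (\<lambda>u. ou_feature s u * ou_feature t u) (ou_kernel s t)"
proof (rule has_bochner_integral_nn_integral)
  define a where "a = max (-s) (-t)"
  define F where "F u = - exp (- s - t - 2 * u)" for u :: real
  have eq: "ennreal (ou_feature s u * ou_feature t u) =
      ennreal (2 * exp (- s - t - 2 * u)) * indicator {a..} u" for u
    by (auto simp: ou_feature_def a_def indicator_def algebra_simps simp flip: exp_add)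
  have "(\<integral>\<^sup>+u. ennreal (ou_feature s u * ou_feature t u) \<partial>lborel) = ennreal (0 - F a)"
    unfolding eq
  proof (rule nn_integral_FTC_atLeast)
    show "DERIV F u :> 2 * exp (- s - t - 2 * u)" for u
      unfolding F_def by (auto intro!: derivative_eq_intros)
    show "(F \<longlongrightarrow> 0) at_top" unfolding F_def by real_asymp
  qed auto
  \<comment> \<open>Here \<open>a = - min s t\<close>, so the exponent
    \<open>- s - t - 2 * a\<close> is \<open>- |s - t|\<close>.\<close>
  also have "0 - F a = ou_kernel s t" by (auto simp: F_def a_def ou_kernel_def max_def)
  finally show "(\<integral>\<^sup>+u. ennreal (ou_feature s u * ou_feature t u) \<partial>lborel) = ennreal (ou_kernel s t)" .
qed (auto simp: ou_feature_def[abs_def] less_imp_le)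

interpretation ou: psd_kernel ou_kernel
proof
  fix a :: "real \<Rightarrow>\<^sub>0 real"
  let ?K = "Poly_Mapping.keys a" and ?c = "Poly_Mapping.lookup a"
  note int = has_bochner_integral_ou_feature[THEN integrable.intros]
  have "ker_inner ou_kernel a a = (\<Sum>s\<in>?K. \<Sum>t\<in>?K. \<integral>u. ?c s * ?c t * (ou_feature s u * ou_feature t u) \<partial>lborel)"
    by (simp add: ker_inner_def has_bochner_integral_integral_eq[OF has_bochner_integral_ou_feature])
  also have "\<dots> = (\<integral>u. (\<Sum>s\<in>?K. \<Sum>t\<in>?K. ?c s * ?c t * (ou_feature s u * ou_feature t u)) \<partial>lborel)"
    using int by (subst Bochner_Integration.integral_sum; (subst Bochner_Integration.integral_sum)?) (auto intro!: Bochner_Integration.integrable_sum)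
  also have "\<dots> = (\<integral>u. (\<Sum>s\<in>?K. ?c s * ou_feature s u)\<^sup>2 \<partial>lborel)"
    by (simp add: power2_eq_square sum_product mult_ac)
  also have "\<dots> \<ge> 0" by simp
  finally show "ker_inner ou_kernel a a \<ge> 0" .
qed (rule ou_kernel_commute)

section \<open>Lebesgue measure on [0,1] and existence of \<open>h\<close>\<close>

abbreviation unit_leb :: "real measure" where
  "unit_leb \<equiv> restrict_space lborel {0..1}"

lemma space_unit_leb [simp]: "space unit_leb = {0..1}"
  by simp

interpretation unit_leb: prob_space unit_leb
  by (rule prob_spaceI) (simp add: emeasure_restrict_space)

lemma borel_measurable_unit_leb:
  "f \<in> borel_measurable borel \<Longrightarrow> f \<in> borel_measurable unit_leb"
  by (rule measurable_restrict_space1) simp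

lemma id_unit_leb: "(\<lambda>x. x) \<in> borel_measurable unit_leb"
  by (rule borel_measurable_unit_leb) simp

lemma continuous_imp_unit_leb_measurable:
  fixes f :: "real \<Rightarrow> real" shows "continuous_on UNIV f \<Longrightarrow> f \<in> borel_measurable unit_leb"
  by (intro borel_measurable_unit_leb borel_measurable_continuous_onI)

lemma continuous_bounded_unit:
  fixes f :: "real \<Rightarrow> real" assumes "continuous_on UNIV f"
  obtains B where "B \<ge> 0" "\<And>x. x \<in> {0..1} \<Longrightarrow> \<bar>f x\<bar> \<le> B"
proof -
  have "compact (f ` {0..1})"
    using assms by (intro compact_continuous_image) (auto intro: continuous_on_subset)
  then have "bounded (f ` {0..1})" by (rule compact_imp_bounded)
  then obtain B where B: "\<forall>x\<in>{0..1}. \<bar>f x\<bar> \<le> B" unfolding bounded_iff by auto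
  from this[rule_format, of 0] have "B \<ge> 0" by simp
  with B show thesis by (intro that) blast+
qed

lemma continuous_integrable_unit:
  fixes f :: "real \<Rightarrow> real" assumes "continuous_on UNIV f" shows "integrable unit_leb f"
proof -
  obtain B where "\<And>x. x \<in> {0..1} \<Longrightarrow> \<bar>f x\<bar> \<le> B"
    using continuous_bounded_unit[OF assms] by blast
  then show ?thesis
    using assms by (intro unit_leb.integrable_const_bound[of _ B] AE_I2 continuous_imp_unit_leb_measurable) auto
qed

text \<open>The symmetric Schroedinger system of the entropy problem. The right-hand side sees
  \<open>h\<close> only on [0,1], but the equation is imposed on the whole line, since
  \<open>h (s / c)\<close> has to be a Gaussian competitor at every real \<open>s\<close>.\<close>

locale schroedinger =
  fixes c :: real and h :: "real \<Rightarrow> real"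
  assumes c_pos: "c > 0"
    and h_cont: "continuous_on UNIV h"
    and h_pos: "h x > 0"
    and h_eq: "h x = (\<integral>y. ou_kernel (c * x) (c * y) / h y \<partial>unit_leb)"

lemma exists_schroedinger:
  assumes c: "c > 0" shows "\<exists>h. schroedinger c h"
proof -
  note [measurable] = id_unit_leb
  define k where "k x y = ou_kernel (c * x) (c * y)" for x y
  \<comment> \<open>On the unit square \<open>|x - y|\<close> is at most 1, so
    \<open>exp (- c)\<close> is the least value of the kernel.\<close>
  interpret K: bounded_kernel unit_leb k "exp (- c)"
  proof
    have [measurable]: "fst \<in> borel_measurable (unit_leb \<Otimes>\<^sub>M unit_leb)" "snd \<in> borel_measurable (unit_leb \<Otimes>\<^sub>M unit_leb)"
      using measurable_compose[OF measurable_fst id_unit_leb] measurable_compose[OF measurable_snd id_unit_leb]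
      by auto
    show "case_prod k \<in> borel_measurable (unit_leb \<Otimes>\<^sub>M unit_leb)"
      unfolding k_def split_beta' by measurable
    show "exp (- c) \<le> k x y" if "x \<in> space unit_leb" "y \<in> space unit_leb" for x y
    proof -
      have "c * \<bar>x - y\<bar> \<le> c * 1" using that c by (intro mult_left_mono) auto
      then show ?thesis using c by (simp add: k_def ou_kernel_def abs_mult flip: right_diff_distrib)
    qed
  qed (auto simp: k_def ou_kernel_le_1)
  obtain h0 where h0: "K.pos_bdd h0" and fix0: "\<And>x. x \<in> {0..1} \<Longrightarrow> h0 x = K.T h0 x"
    using K.exists_fixed_point by auto
  note [measurable] = K.pos_bddD(1)[OF h0]
  obtain a where a: "a > 0" "\<And>y. y \<in> {0..1} \<Longrightarrow> a \<le> h0 y"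
    using h0 unfolding K.pos_bdd_def by auto
  \<comment> \<open>The equation itself extends the fixed point from [0,1] to the line. The
    extension is Lipschitz because the kernel is, with constant \<open>c\<close>, while
    \<open>h0\<close> is at least \<open>a\<close>.\<close>
  define h where "h x = (\<integral>y. k x y / h0 y \<partial>unit_leb)" for x
  have int: "integrable unit_leb (\<lambda>y. k x y / h0 y)" for x
  proof (rule unit_leb.integrable_const_bound[of _ "1 / a"])
    show "AE y in unit_leb. norm (k x y / h0 y) \<le> 1 / a"
    proof (rule AE_I2)
      fix y assume "y \<in> space unit_leb"
      then have "a \<le> h0 y" using a by simp
      then show "norm (k x y / h0 y) \<le> 1 / a"
        using a ou_kernel_le_1[of "c * x" "c * y"] less_imp_le[OF ou_kernel_pos[of "c * x" "c * y"]]
        by (auto simp: k_def intro!: frac_le)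
    qed
  qed (simp add: k_def)
  have hh0: "h x = h0 x" if "x \<in> {0..1}" for x using fix0[OF that] by (simp add: h_def K.T_def)
  have hpos: "h x > 0" for x
    unfolding h_def using int K.pos_bddD(2)[OF h0] by (intro unit_leb.integral_pos) (auto simp: k_def)
  have lip: "\<bar>h x - h x'\<bar> \<le> c / a * \<bar>x - x'\<bar>" for x x'
  proof -
    have "\<bar>h x - h x'\<bar> = \<bar>\<integral>y. k x y / h0 y - k x' y / h0 y \<partial>unit_leb\<bar>"
      unfolding h_def using int by simp
    also have "\<dots> \<le> (\<integral>y. \<bar>k x y / h0 y - k x' y / h0 y\<bar> \<partial>unit_leb)"
      using integral_norm_bound[of unit_leb "\<lambda>y. k x y / h0 y - k x' y / h0 y"] by simp
    also have "\<dots> \<le> (\<integral>y. c / a * \<bar>x - x'\<bar> \<partial>unit_leb)"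
    proof (rule integral_mono)
      show "integrable unit_leb (\<lambda>y. \<bar>k x y / h0 y - k x' y / h0 y\<bar>)"
        using int by (intro integrable_abs Bochner_Integration.integrable_diff)
      fix y assume y: "y \<in> space unit_leb"
      have "\<bar>k x y - k x' y\<bar> \<le> \<bar>c * x - c * x'\<bar>"
        using ou_kernel_Lipschitz[of "c * x" "c * y" "c * x'" "c * y"] by (simp add: k_def)
      also have "\<dots> = c * \<bar>x - x'\<bar>" using c by (simp add: abs_mult flip: right_diff_distrib)
      finally have "\<bar>k x y - k x' y\<bar> / h0 y \<le> c * \<bar>x - x'\<bar> / a"
        using a y c by (intro frac_le) auto
      then show "\<bar>k x y / h0 y - k x' y / h0 y\<bar> \<le> c / a * \<bar>x - x'\<bar>"
        using K.pos_bddD(2)[OF h0, of y] y by (simp flip: diff_divide_distrib)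
    qed simp
    finally show ?thesis by (simp add: unit_leb.prob_space[simplified])
  qed
  have h_cont: "continuous_on UNIV h"
    using lip a c by (intro lipschitz_on_continuous_on[of "c / a"] lipschitz_onI) (auto simp: dist_real_def)
  have h_eq: "h x = (\<integral>y. k x y / h y \<partial>unit_leb)" for x
    unfolding h_def[of x] by (intro Bochner_Integration.integral_cong) (auto simp: hh0)
  have "schroedinger c h"
    using c h_cont hpos h_eq unfolding k_def by (rule schroedinger.intro)
  then show ?thesis by blast
qed

subsection \<open>Integrals of kernel functions as elements of the space\<close>

text \<open>The image of the measure with density \<open>w\<close> on \<open>[0,1]\<close> under \<open>x \<mapsto> c * grid n x\<close>. The last cell
  meets \<open>[0,1]\<close> only in \<open>1\<close>.\<close>

definition cells :: "real \<Rightarrow> (real \<Rightarrow> real) \<Rightarrow> nat \<Rightarrow> real \<Rightarrow>\<^sub>0 real" where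
  "cells c w n = (\<Sum>i\<le>Suc n. Poly_Mapping.single (c * (real i / real (Suc n)))
     (\<integral>x. indicator {real i / real (Suc n)..<real (Suc i) / real (Suc n)} x * w x \<partial>unit_leb))"

definition grid :: "nat \<Rightarrow> real \<Rightarrow> real" where
  "grid n x = of_int \<lfloor>real (Suc n) * x\<rfloor> / real (Suc n)"

lemma grid_measurable [measurable]: "grid n \<in> borel_measurable borel"
  unfolding grid_def by measurable

lemma grid_close: "\<bar>grid n x - x\<bar> \<le> 1 / real (Suc n)"
proof -
  have "\<bar>of_int \<lfloor>real (Suc n) * x\<rfloor> - real (Suc n) * x\<bar> \<le> 1" by linarith
  then have "\<bar>of_int \<lfloor>real (Suc n) * x\<rfloor> - real (Suc n) * x\<bar> / real (Suc n) \<le> 1 / real (Suc n)"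
    by (intro divide_right_mono) auto
  moreover have "\<bar>grid n x - x\<bar> = \<bar>of_int \<lfloor>real (Suc n) * x\<rfloor> - real (Suc n) * x\<bar> / real (Suc n)"
  proof -
    have "grid n x - x = (of_int \<lfloor>real (Suc n) * x\<rfloor> - real (Suc n) * x) / real (Suc n)"
      by (simp add: grid_def diff_divide_distrib del: of_nat_Suc)
    then show ?thesis by (simp add: abs_divide del: of_nat_Suc)
  qed
  ultimately show ?thesis by simp
qed

lemma const_over_Suc_tendsto: "(\<lambda>n. (K :: real) / real (Suc n)) \<longlonglongrightarrow> 0"
  using tendsto_mult_right_zero[OF LIMSEQ_inverse_real_of_nat, of K] by (simp add: divide_inverse)

lemma sum_cells:
  assumes x: "x \<in> {0..1}"
  shows "(\<Sum>i\<le>Suc n. g (real i / real (Suc n)) *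
     indicator {real i / real (Suc n)..<real (Suc i) / real (Suc n)} x) = (g (grid n x) :: real)"
proof -
  define N where "N = real (Suc n)"
  have N: "N > 0" by (simp add: N_def)
  define j where "j = nat \<lfloor>N * x\<rfloor>"
  have nn: "0 \<le> N * x" using x N by simp
  have le: "N * x \<le> N" using x N by (simp add: mult_left_le)
  have j: "real j = of_int \<lfloor>N * x\<rfloor>" using nn by (simp add: j_def)
  then have "real j \<le> N" using le by linarith
  then have jn: "j \<le> Suc n" by (simp add: N_def)
  have iff: "x \<in> {real i / N..<real (Suc i) / N} \<longleftrightarrow> i = j" for i
  proof -
    have "x \<in> {real i / N..<real (Suc i) / N} \<longleftrightarrow> real i \<le> N * x \<and> N * x < real i + 1"
      using N by (auto simp: field_simps)
    also have "\<dots> \<longleftrightarrow> \<lfloor>N * x\<rfloor> = int i" by (simp add: floor_eq_iff)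
    also have "\<dots> \<longleftrightarrow> i = j" using nn by (auto simp: j_def)
    finally show ?thesis .
  qed
  have "(\<Sum>i\<le>Suc n. g (real i / N) * indicator {real i / N..<real (Suc i) / N} x) =
     (\<Sum>i\<le>Suc n. if i = j then g (real i / N) else 0)"
    by (intro sum.cong refl) (simp only: indicator_def iff, simp)
  also have "\<dots> = g (real j / N)" using jn by simp
  finally show ?thesis unfolding grid_def N_def[symmetric] j[symmetric] .
qed

text \<open>Turns sums over cells into integrals over points rounded to the grid, so that
  discretisation errors are estimated under the integral by \<open>grid_close\<close>.\<close>

lemma pairing_cells:
  assumes w: "continuous_on UNIV w"
  shows "pairing (cells c w n) g = (\<integral>x. g (c * grid n x) * w x \<partial>unit_leb)"
proof -
  let ?I = "\<lambda>i. {real i / real (Suc n)..<real (Suc i) / real (Suc n)}"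
  have int: "integrable unit_leb (\<lambda>x. indicator (?I i) x * w x)" for i
  proof -
    obtain B where "\<And>x. x \<in> {0..1} \<Longrightarrow> \<bar>w x\<bar> \<le> B" "B \<ge> 0"
      using continuous_bounded_unit[OF w] by blast
    then show ?thesis
      using borel_measurable_continuous_onI[OF w]
      by (intro unit_leb.integrable_const_bound[of _ B] AE_I2 borel_measurable_unit_leb)
        (auto simp: indicator_def)
  qed
  have "pairing (cells c w n) g = (\<Sum>i\<le>Suc n. \<integral>x. g (c * (real i / real (Suc n))) * (indicator (?I i) x * w x) \<partial>unit_leb)"
    unfolding cells_def pairing_sum pairing_single by (simp only: integral_mult_right_zero mult.commute)
  also have "\<dots> = (\<integral>x. (\<Sum>i\<le>Suc n. g (c * (real i / real (Suc n))) * (indicator (?I i) x * w x)) \<partial>unit_leb)"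
    using int by (intro Bochner_Integration.integral_sum[symmetric] integrable_mult_right)
  also have "\<dots> = (\<integral>x. g (c * grid n x) * w x \<partial>unit_leb)"
  proof (rule Bochner_Integration.integral_cong[OF refl])
    fix x assume "x \<in> space unit_leb"
    then have "x \<in> {0..1}" by simp
    from sum_cells[OF this, of "\<lambda>y. g (c * y)" n]
    show "(\<Sum>i\<le>Suc n. g (c * (real i / real (Suc n))) * (indicator (?I i) x * w x)) = g (c * grid n x) * w x"
      by (simp only: sum_distrib_right[symmetric] mult.assoc[symmetric])
  qed
  finally show ?thesis .
qed

locale kernel_embedding =
  fixes c :: real and w :: "real \<Rightarrow> real"
  assumes c: "c > 0" and w: "continuous_on UNIV w"
begin

text \<open>The kernel mean embedding of the image of the signed measure \<open>w x dx\<close> under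
  \<open>x \<mapsto> c * x\<close>; \<open>W\<close> below is the total variation of that density on
  [0,1].\<close>

definition embed :: "real \<Rightarrow> real" where
  "embed t = (\<integral>y. ou_kernel (c * y) t * w y \<partial>unit_leb)"

definition W :: real where "W = (\<integral>x. \<bar>w x\<bar> \<partial>unit_leb)"

lemma W_nonneg: "W \<ge> 0"
  by (simp add: W_def)

lemma w_int: "integrable unit_leb w" "integrable unit_leb (\<lambda>x. \<bar>w x\<bar>)"
  using continuous_integrable_unit[OF w] by auto

lemma w_measurable [measurable]: "w \<in> borel_measurable borel"
  using w by (rule borel_measurable_continuous_onI)

lemma integrable_mult_w:
  assumes f: "f \<in> borel_measurable borel" and B: "\<And>x. \<bar>f x\<bar> \<le> B"
  shows "integrable unit_leb (\<lambda>x. f x * w x)"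
proof (rule Bochner_Integration.integrable_bound)
  show "integrable unit_leb (\<lambda>x. B * \<bar>w x\<bar>)" using w_int by simp
  show "(\<lambda>x. f x * w x) \<in> borel_measurable unit_leb"
    using f by (intro borel_measurable_unit_leb) simp
  have "B \<ge> 0" using B[of 0] by simp
  then show "AE x in unit_leb. norm (f x * w x) \<le> norm (B * \<bar>w x\<bar>)"
    using B by (auto simp: abs_mult intro!: mult_right_mono)
qed

lemma integral_mult_w_le:
  assumes f: "f \<in> borel_measurable borel" and B: "\<And>x. \<bar>f x\<bar> \<le> B"
  shows "\<bar>\<integral>x. f x * w x \<partial>unit_leb\<bar> \<le> B * W"
proof -
  have "\<bar>\<integral>x. f x * w x \<partial>unit_leb\<bar> \<le> (\<integral>x. \<bar>f x * w x\<bar> \<partial>unit_leb)"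
    using integral_norm_bound[of unit_leb "\<lambda>x. f x * w x"] by simp
  also have "\<dots> \<le> (\<integral>x. B * \<bar>w x\<bar> \<partial>unit_leb)"
    using B by (intro integral_mono integrable_abs integrable_mult_w[OF assms] integrable_mult_right w_int)
      (auto simp: abs_mult intro!: mult_right_mono)
  finally show ?thesis by (simp add: W_def)
qed

lemma ou_int: "integrable unit_leb (\<lambda>y. ou_kernel (c * f y) t * w y)" if "f \<in> borel_measurable borel" for f
  using that by (intro integrable_mult_w[of _ 1] abs_ou_kernel_le_1) measurable

lemma embed_Lipschitz: "\<bar>embed s - embed t\<bar> \<le> \<bar>s - t\<bar> * W"
proof -
  have "embed s - embed t = (\<integral>y. (ou_kernel (c * y) s - ou_kernel (c * y) t) * w y \<partial>unit_leb)"
    using ou_int[of "\<lambda>y. y"] by (simp add: embed_def left_diff_distrib)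
  also have "\<bar>\<dots>\<bar> \<le> \<bar>s - t\<bar> * W"
  proof (rule integral_mult_w_le)
    show "\<bar>ou_kernel (c * y) s - ou_kernel (c * y) t\<bar> \<le> \<bar>s - t\<bar>" for y
      using ou_kernel_Lipschitz[of "c * y" s "c * y" t] by simp
  qed measurable
  finally show ?thesis .
qed

lemma continuous_on_embed: "continuous_on UNIV embed"
  using embed_Lipschitz W_nonneg
  by (intro lipschitz_on_continuous_on[of W] lipschitz_onI) (auto simp: dist_real_def mult.commute)

lemma embed_measurable [measurable]: "embed \<in> borel_measurable borel"
  using continuous_on_embed by (rule borel_measurable_continuous_onI)

lemma comb_cells: "ker_comb ou_kernel (cells c w n) t = (\<integral>y. ou_kernel (c * grid n y) t * w y \<partial>unit_leb)"
  unfolding ker_comb_pairing by (rule pairing_cells[OF w])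

lemma comb_cells_close: "\<bar>ker_comb ou_kernel (cells c w n) t - embed t\<bar> \<le> c / real (Suc n) * W"
proof -
  have "ker_comb ou_kernel (cells c w n) t - embed t =
      (\<integral>y. (ou_kernel (c * grid n y) t - ou_kernel (c * y) t) * w y \<partial>unit_leb)"
    unfolding comb_cells embed_def left_diff_distrib
    using ou_int[OF grid_measurable] ou_int[of "\<lambda>y. y"]
    by (intro Bochner_Integration.integral_diff[symmetric]) auto
  also have "\<bar>\<dots>\<bar> \<le> c / real (Suc n) * W"
  proof (rule integral_mult_w_le)
    fix y
    have "\<bar>ou_kernel (c * grid n y) t - ou_kernel (c * y) t\<bar> \<le> \<bar>c * grid n y - c * y\<bar>"
      using ou_kernel_Lipschitz[of "c * grid n y" t "c * y" t] by simp
    also have "\<dots> = c * \<bar>grid n y - y\<bar>" using c by (simp add: abs_mult flip: right_diff_distrib)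
    also have "\<dots> \<le> c * (1 / real (Suc n))" using c by (intro mult_left_mono grid_close) auto
    finally show "\<bar>ou_kernel (c * grid n y) t - ou_kernel (c * y) t\<bar> \<le> c / real (Suc n)" by simp
  qed measurable
  finally show ?thesis .
qed

lemma comb_cells_tendsto: "(\<lambda>n. ker_comb ou_kernel (cells c w n) t) \<longlonglongrightarrow> embed t"
proof (rule LIM_zero_cancel, rule Lim_null_comparison)
  show "\<forall>\<^sub>F n in sequentially. norm (ker_comb ou_kernel (cells c w n) t - embed t) \<le> c / real (Suc n) * W"
    using comb_cells_close by simp
  show "(\<lambda>n. c / real (Suc n) * W) \<longlonglongrightarrow> 0"
    using const_over_Suc_tendsto[of "c * W"] by simp
qed

definition embed_sqnorm :: real where "embed_sqnorm = (\<integral>x. embed (c * x) * w x \<partial>unit_leb)"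

text \<open>Rounding the evaluation point costs \<open>c * W / (m + 1)\<close>, replacing the
  combination by \<open>embed\<close> costs \<open>c * W / (n + 1)\<close>, and integration against
  \<open>w\<close> adds a factor \<open>W\<close>. The indices are independent so that the squared
  norm of a difference can be expanded.\<close>

lemma inner_cells_close:
  "\<bar>ker_inner ou_kernel (cells c w m) (cells c w n) - embed_sqnorm\<bar> \<le> c * W\<^sup>2 * (1 / real (Suc m) + 1 / real (Suc n))"
proof -
  let ?f = "ker_comb ou_kernel (cells c w n)"
  have bd: "\<bar>?f (c * grid m x) - embed (c * x)\<bar> \<le> c * W * (1 / real (Suc m) + 1 / real (Suc n))" for x
  proof -
    have "\<bar>embed (c * grid m x) - embed (c * x)\<bar> \<le> \<bar>c * grid m x - c * x\<bar> * W" by (rule embed_Lipschitz)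
    also have "\<dots> = c * \<bar>grid m x - x\<bar> * W" using c by (simp add: abs_mult flip: right_diff_distrib)
    also have "\<dots> \<le> c * (1 / real (Suc m)) * W"
      using c W_nonneg by (intro mult_right_mono mult_left_mono grid_close) auto
    finally show ?thesis
      using comb_cells_close[of n "c * grid m x"] by (simp add: algebra_simps)
  qed
  have fm [measurable]: "?f \<in> borel_measurable borel" unfolding ker_comb_def by measurable
  have fb: "\<bar>?f t\<bar> \<le> ker_norm ou_kernel (cells c w n)" for t using ou.comb_le[of "cells c w n" t] by simp
  have eb: "\<bar>embed t\<bar> \<le> 1 * W" for t unfolding embed_def
    by (intro integral_mult_w_le abs_ou_kernel_le_1) measurable
  have "ker_inner ou_kernel (cells c w m) (cells c w n) - embed_sqnorm =
      (\<integral>x. (?f (c * grid m x) - embed (c * x)) * w x \<partial>unit_leb)"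
    unfolding ou.inner_comb pairing_cells[OF w] embed_sqnorm_def left_diff_distrib
    by (intro Bochner_Integration.integral_diff[symmetric] integrable_mult_w[OF _ fb] integrable_mult_w[OF _ eb]) measurable
  also have "\<bar>\<dots>\<bar> \<le> c * W * (1 / real (Suc m) + 1 / real (Suc n)) * W"
    by (intro integral_mult_w_le bd) measurable
  finally show ?thesis by (simp add: power2_eq_square algebra_simps)
qed

lemma inner_cells_tendsto: "(\<lambda>n. ker_inner ou_kernel (cells c w n) (cells c w n)) \<longlonglongrightarrow> embed_sqnorm"
proof (rule LIM_zero_cancel, rule Lim_null_comparison)
  show "\<forall>\<^sub>F n in sequentially. norm (ker_inner ou_kernel (cells c w n) (cells c w n) - embed_sqnorm)
      \<le> c * W\<^sup>2 * (1 / real (Suc n) + 1 / real (Suc n))"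
    using inner_cells_close by (intro always_eventually allI) (simp only: real_norm_def)
  show "(\<lambda>n. c * W\<^sup>2 * (1 / real (Suc n) + 1 / real (Suc n))) \<longlonglongrightarrow> 0"
    using const_over_Suc_tendsto[of "2 * c * W\<^sup>2"] by (simp add: mult_ac)
qed

lemma embed_represents: "rkhs_represents ou_kernel (cells c w) embed"
  unfolding rkhs_represents_def
proof (intro conjI allI impI comb_cells_tendsto)
  fix e :: real assume e: "e > 0"
  define K where "K = c * W\<^sup>2"
  have K: "K \<ge> 0" using c by (simp add: K_def)
  \<comment> \<open>The expanded square has inner products with coefficients 1, -2, 1, each within
    \<open>2 * K / (N + 1)\<close> of the same number; the coefficients cancel and the errors add up
    to \<open>8 * K / (N + 1)\<close>.\<close>
  have "(\<lambda>n. 8 * K * (1 / real (Suc n))) \<longlonglongrightarrow> 0"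
    using const_over_Suc_tendsto[of "8 * K"] by simp
  then have "\<forall>\<^sub>F n in sequentially. 8 * K * (1 / real (Suc n)) < e\<^sup>2"
    using e by (intro order_tendstoD(2)) auto
  then obtain N where N: "8 * K * (1 / real (Suc N)) < e\<^sup>2" by (auto simp: eventually_sequentially)
  show "\<exists>N. \<forall>m\<ge>N. \<forall>n\<ge>N. ker_norm ou_kernel (cells c w m - cells c w n) < e"
  proof (intro exI[of _ N] allI impI)
    fix m n assume mn: "m \<ge> N" "n \<ge> N"
    let ?i = "\<lambda>m n. ker_inner ou_kernel (cells c w m) (cells c w n)"
    have r: "1 / real (Suc p) \<le> 1 / real (Suc N)" if "p \<ge> N" for p using that by (intro divide_left_mono) auto
    have b: "\<bar>?i p q - embed_sqnorm\<bar> \<le> 2 * K * (1 / real (Suc N))" if "p \<ge> N" "q \<ge> N" for p q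
    proof -
      have "\<bar>?i p q - embed_sqnorm\<bar> \<le> K * (1 / real (Suc p) + 1 / real (Suc q))"
        using inner_cells_close unfolding K_def .
      also have "\<dots> \<le> K * (1 / real (Suc N) + 1 / real (Suc N))"
        using K r[OF that(1)] r[OF that(2)] by (intro mult_left_mono add_mono)
      finally show ?thesis by (simp add: mult.commute)
    qed
    have "(ker_norm ou_kernel (cells c w m - cells c w n))\<^sup>2 = ?i m m - 2 * ?i m n + ?i n n"
      by (simp add: ou.norm_square ou.inner_linear ou.inner_commute[of "cells c w n" "cells c w m"])
    also have "\<dots> \<le> 8 * K * (1 / real (Suc N))"
      using b[OF mn(1) mn(1)] b[OF mn] b[OF mn(2) mn(2)] by linarith
    finally have "(ker_norm ou_kernel (cells c w m - cells c w n))\<^sup>2 < e\<^sup>2" using N by linarith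
    then show "ker_norm ou_kernel (cells c w m - cells c w n) < e"
      using e by (intro power_less_imp_less_base[of _ 2 e]) auto
  qed
qed

lemma embed_rkhs: "embed \<in> rkhs ou_kernel"
  using embed_represents unfolding rkhs_def by blast

lemma rkhs_norm_embed: "(rkhs_norm ou_kernel embed)\<^sup>2 = embed_sqnorm"
proof (rule LIMSEQ_unique[OF _ inner_cells_tendsto])
  show "(\<lambda>n. ker_inner ou_kernel (cells c w n) (cells c w n)) \<longlonglongrightarrow> (rkhs_norm ou_kernel embed)\<^sup>2"
    using tendsto_power[OF ou.rkhs_norm_tendsto[OF embed_represents], of 2] by (simp add: ou.norm_square)
qed

lemma integral_comb:
  "pairing a embed = (\<integral>y. ker_comb ou_kernel a (c * y) * w y \<partial>unit_leb)"
proof -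
  have "(\<integral>y. ker_comb ou_kernel a (c * y) * w y \<partial>unit_leb) =
      (\<Sum>s\<in>Poly_Mapping.keys a. \<integral>y. Poly_Mapping.lookup a s * (ou_kernel (c * y) s * w y) \<partial>unit_leb)"
    unfolding ker_comb_def sum_distrib_right using ou_int[of "\<lambda>y. y"]
    by (subst Bochner_Integration.integral_sum[symmetric]) (auto simp: ou_kernel_commute mult.assoc)
  then show ?thesis by (simp add: pairing_def embed_def)
qed

text \<open>Nonnegativity of the squared norm of \<open>a - cells c w n\<close>, in the limit.\<close>

lemma inner_ge_embed:
  "2 * (\<integral>y. ker_comb ou_kernel a (c * y) * w y \<partial>unit_leb) - embed_sqnorm \<le> ker_inner ou_kernel a a"
proof -
  let ?b = "cells c w"
  have "(\<lambda>n. ker_inner ou_kernel a a - 2 * ker_inner ou_kernel a (?b n) + ker_inner ou_kernel (?b n) (?b n))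
    \<longlonglongrightarrow> ker_inner ou_kernel a a - 2 * pairing a embed + embed_sqnorm"
    unfolding ou.inner_comb[of a "?b _"]
    by (intro tendsto_intros inner_cells_tendsto pairing_tendsto comb_cells_tendsto)
  moreover have "0 \<le> ker_inner ou_kernel a a - 2 * ker_inner ou_kernel a (?b n) + ker_inner ou_kernel (?b n) (?b n)" for n
    using ou.k_psd[of "a - ?b n"] by (simp add: ou.inner_linear ou.inner_commute[of "?b n" a])
  ultimately have "0 \<le> ker_inner ou_kernel a a - 2 * pairing a embed + embed_sqnorm"
    by (intro LIMSEQ_le_const) auto
  then show ?thesis by (simp add: integral_comb)
qed

end

subsection \<open>The Gaussian problem\<close>

text \<open>The positive part grows and the negative part shrinks, and extended subtraction respects
  this even at infinite values. This covers the value \<open>-\<infinity>\<close> of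
  \<open>ext_log\<close> and entropy densities with infinite integral.\<close>

lemma ereal_integral_mono_AE:
  assumes "AE x in M. f x \<le> g x" shows "ereal_integral M f \<le> ereal_integral M g"
proof -
  have "AE x in M. e2ennreal (f x) \<le> e2ennreal (g x)"
    using assms by eventually_elim (rule e2ennreal_mono)
  moreover have "AE x in M. e2ennreal (- g x) \<le> e2ennreal (- f x)"
    using assms by eventually_elim (simp add: e2ennreal_mono)
  ultimately show ?thesis
    unfolding ereal_integral_def
    by (intro ereal_minus_mono less_eq_ennreal.rep_eq[THEN iffD1] nn_integral_mono_AE)
qed

lemma ereal_integral_cong_AE:
  assumes "AE x in M. f x = g x" shows "ereal_integral M f = ereal_integral M g"
  using assms by (intro antisym ereal_integral_mono_AE) (auto elim: eventually_mono)

lemma ereal_integral_ereal: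
  assumes "integrable M f" shows "ereal_integral M (\<lambda>x. ereal (f x)) = ereal (\<integral>x. f x \<partial>M)"
proof -
  obtain r q where "r \<ge> 0" "q \<ge> 0" "(\<integral>\<^sup>+x. ennreal (f x) \<partial>M) = ennreal r" "(\<integral>\<^sup>+x. ennreal (- f x) \<partial>M) = ennreal q"
      "f \<in> borel_measurable M" "integral\<^sup>L M f = r - q"
    using integrableE[OF assms] by metis
  then show ?thesis by (simp add: ereal_integral_def enn2ereal_ennreal)
qed

lemma continuous_on_scaled:
  fixes f :: "real \<Rightarrow> real" shows "continuous_on UNIV f \<Longrightarrow> continuous_on UNIV (\<lambda>x. f (r * x))"
  by (rule continuous_on_compose2[of UNIV f]) (auto intro!: continuous_intros)

lemma continuous_on_ker_comb_ou: "continuous_on UNIV (\<lambda>x. ker_comb ou_kernel a (r * x))"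
  unfolding ker_comb_def by (intro continuous_intros)

lemma
  fixes f :: "real \<Rightarrow> real"
  assumes c: "c > 0" and f: "continuous_on UNIV f"
  shows integrable_rescale: "integrable (restrict_space lborel {0..c}) f"
    and integral_rescale: "(\<integral>s. f s \<partial>restrict_space lborel {0..c}) = c * (\<integral>x. f (c * x) \<partial>unit_leb)"
proof -
  let ?g = "\<lambda>s. indicator {0..c} s *\<^sub>R f s"
  have g: "?g (0 + c * x) = indicator {0..1} x *\<^sub>R f (c * x)" for x
    using c by (auto simp: indicator_def zero_le_mult_iff)
  have "integrable unit_leb (\<lambda>x. f (c * x))" by (intro continuous_integrable_unit continuous_on_scaled f)
  then have "integrable lborel (\<lambda>x. ?g (0 + c * x))" unfolding g by (simp add: integrable_restrict_space)
  then show "integrable (restrict_space lborel {0..c}) f"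
    using c lborel_integrable_real_affine_iff[of c ?g 0] by (simp add: integrable_restrict_space)
  have "(\<integral>s. f s \<partial>restrict_space lborel {0..c}) = integral\<^sup>L lborel ?g" by (simp add: integral_restrict_space)
  also have "\<dots> = c * integral\<^sup>L lborel (\<lambda>x. ?g (0 + c * x))"
    using lborel_integral_real_affine[of c ?g 0] c by simp
  also have "\<dots> = c * (\<integral>x. f (c * x) \<partial>unit_leb)" unfolding g by (simp add: integral_restrict_space)
  finally show "(\<integral>s. f s \<partial>restrict_space lborel {0..c}) = c * (\<integral>x. f (c * x) \<partial>unit_leb)" .
qed

interpretation unit_pair: pair_prob_space unit_leb unit_leb ..

context schroedinger
begin

lemma h_measurable [measurable]: "h \<in> borel_measurable borel"
  using h_cont by (rule borel_measurable_continuous_onI)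

lemma h_nz [simp]: "h x \<noteq> 0"
  using h_pos[of x] by simp

lemma kernel_embedding: "continuous_on UNIV w \<Longrightarrow> kernel_embedding c w"
  using c_pos by unfold_locales

text \<open>Schur's test: \<open>h\<close> is a positive eigenfunction, with eigenvalue \<open>1\<close>, of the kernel with respect to
  the measure with density \<open>1 / h\<^sup>2\<close>.\<close>

lemma embed_sqnorm_le:
  assumes w: "continuous_on UNIV w"
  shows "kernel_embedding.embed_sqnorm c w \<le> (\<integral>x. (w x)\<^sup>2 * (h x)\<^sup>2 \<partial>unit_leb)"
proof -
  interpret K: kernel_embedding c w using kernel_embedding[OF w] .
  define k where "k x y = ou_kernel (c * x) (c * y)" for x y
  \<comment> \<open>The Schur weight: AM-GM bounds \<open>k x y * w y * w x\<close> by the mean of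
    \<open>P x y\<close> and \<open>P y x\<close>. Integrating \<open>P x y\<close> over
    \<open>y\<close> uses the equation for \<open>h\<close>; by Fubini the swapped term has the same
    double integral.\<close>
  define P where "P x y = k x y * (w x)\<^sup>2 * h x / h y" for x y
  have [continuous_intros]: "continuous_on UNIV (\<lambda>y. k x y)" "continuous_on UNIV (\<lambda>x. k x y)" for x y
    unfolding k_def by (intro continuous_intros)+
  note [continuous_intros] = w h_cont
  have kint: "integrable unit_leb (\<lambda>y. k x y / h y)" for x
    by (intro continuous_integrable_unit continuous_intros) simp
  have P1: "(\<integral>y. P x y \<partial>unit_leb) = (w x)\<^sup>2 * (h x)\<^sup>2" for x
  proof -
    have "(\<integral>y. P x y \<partial>unit_leb) = (\<integral>y. ((w x)\<^sup>2 * h x) * (k x y / h y) \<partial>unit_leb)"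
      by (simp add: P_def mult_ac)
    also have "\<dots> = ((w x)\<^sup>2 * h x) * h x"
      unfolding integral_mult_right_zero k_def h_eq[of x, symmetric] ..
    finally show ?thesis by (simp add: power2_eq_square)
  qed
  have Pint: "integrable (unit_leb \<Otimes>\<^sub>M unit_leb) (case_prod P)"
  proof -
    have wh_cont: "continuous_on UNIV (\<lambda>x. (w x)\<^sup>2 * h x)" and inv_cont: "continuous_on UNIV (\<lambda>x. 1 / h x)"
      by (intro continuous_intros; simp)+
    obtain B where B: "\<And>x. x \<in> {0..1} \<Longrightarrow> \<bar>(w x)\<^sup>2 * h x\<bar> \<le> B"
      using continuous_bounded_unit[OF wh_cont] by blast
    obtain C where C: "\<And>x. x \<in> {0..1} \<Longrightarrow> \<bar>1 / h x\<bar> \<le> C"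
      using continuous_bounded_unit[OF inv_cont] by blast
    have B0: "B \<ge> 0" using B[of 0] by simp
    show ?thesis
    proof (rule unit_pair.P.integrable_const_bound[of _ "B * C"])
      show "AE p in unit_leb \<Otimes>\<^sub>M unit_leb. norm (case_prod P p) \<le> B * C"
      proof (rule AE_I2)
        fix p assume "p \<in> space (unit_leb \<Otimes>\<^sub>M unit_leb)"
        then obtain x y where p: "p = (x, y)" "x \<in> {0..1}" "y \<in> {0..1}" by (auto simp: space_pair_measure)
        have "\<bar>P x y\<bar> = \<bar>k x y\<bar> * (\<bar>(w x)\<^sup>2 * h x\<bar> * \<bar>1 / h y\<bar>)" by (simp add: P_def abs_mult)
        also have "\<dots> \<le> 1 * (B * C)"
          using abs_ou_kernel_le_1 B[OF p(2)] C[OF p(3)] B0 unfolding k_def by (intro mult_mono) auto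
        finally show "norm (case_prod P p) \<le> B * C" by (simp add: p)
      qed
      have [measurable]: "fst \<in> borel_measurable (unit_leb \<Otimes>\<^sub>M unit_leb)" "snd \<in> borel_measurable (unit_leb \<Otimes>\<^sub>M unit_leb)"
        using measurable_compose[OF measurable_fst id_unit_leb] measurable_compose[OF measurable_snd id_unit_leb]
        by auto
      note [measurable] = borel_measurable_continuous_onI[OF w]
      show "case_prod P \<in> borel_measurable (unit_leb \<Otimes>\<^sub>M unit_leb)"
        unfolding split_beta' P_def k_def by measurable
    qed
  qed
  then have Pint': "integrable (unit_leb \<Otimes>\<^sub>M unit_leb) (\<lambda>(x, y). P y x)"
    using unit_pair.integrable_product_swap[of "case_prod P"] by simp
  have w2: "integrable unit_leb (\<lambda>x. (w x)\<^sup>2 * (h x)\<^sup>2)" by (intro continuous_integrable_unit continuous_intros)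
  have swap: "(\<integral>x. \<integral>y. P y x \<partial>unit_leb \<partial>unit_leb) = (\<integral>x. \<integral>y. P x y \<partial>unit_leb \<partial>unit_leb)"
    using unit_pair.Fubini_integral[OF Pint] .
  have swapint: "integrable unit_leb (\<lambda>x. \<integral>y. P y x \<partial>unit_leb)"
    using unit_pair.integrable_fst'[OF Pint'] by simp
  have yint: "integrable unit_leb (\<lambda>y. P x y)" "integrable unit_leb (\<lambda>y. P y x)"
      "integrable unit_leb (\<lambda>y. k x y * w y * w x)" for x
    unfolding P_def by (intro continuous_integrable_unit continuous_intros; simp)+
  have am_gm: "k x y * w y * w x \<le> (P x y + P y x) / 2" for x y
  proof -
    have "0 \<le> (h x * w x - h y * w y)\<^sup>2 / (h x * h y)" using h_pos by (simp add: less_imp_le)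
    also have "\<dots> = (w x)\<^sup>2 * h x / h y + (w y)\<^sup>2 * h y / h x - 2 * (w y * w x)"
      by (simp add: power2_eq_square field_simps)
    finally have "w y * w x \<le> ((w x)\<^sup>2 * h x / h y + (w y)\<^sup>2 * h y / h x) / 2" by simp
    then have "k x y * (w y * w x) \<le> k x y * (((w x)\<^sup>2 * h x / h y + (w y)\<^sup>2 * h y / h x) / 2)"
      unfolding k_def by (intro mult_left_mono less_imp_le[OF ou_kernel_pos])
    also have "\<dots> = (P x y + P y x) / 2"
      using ou_kernel_commute[of "c * x" "c * y"] by (simp add: P_def k_def algebra_simps add_divide_distrib)
    finally show ?thesis by (simp add: mult.assoc)
  qed
  have Q: "K.embed_sqnorm = (\<integral>x. \<integral>y. k x y * w y * w x \<partial>unit_leb \<partial>unit_leb)"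
    unfolding K.embed_sqnorm_def K.embed_def k_def by (simp add: ou_kernel_commute)
  also have "\<dots> \<le> (\<integral>x. ((w x)\<^sup>2 * (h x)\<^sup>2 + (\<integral>y. P y x \<partial>unit_leb)) / 2 \<partial>unit_leb)"
  proof (rule integral_mono)
    show "integrable unit_leb (\<lambda>x. \<integral>y. k x y * w y * w x \<partial>unit_leb)"
    proof -
      have "(\<lambda>x. \<integral>y. k x y * w y * w x \<partial>unit_leb) = (\<lambda>x. K.embed (c * x) * w x)"
        by (simp add: K.embed_def k_def ou_kernel_commute)
      then show ?thesis
        by (simp add: continuous_integrable_unit continuous_on_mult continuous_on_scaled[OF K.continuous_on_embed] w)
    qed
    fix x
    have "(\<integral>y. k x y * w y * w x \<partial>unit_leb) \<le> (\<integral>y. (P x y + P y x) / 2 \<partial>unit_leb)"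
      using yint by (intro integral_mono am_gm integrable_divide Bochner_Integration.integrable_add)
    also have "\<dots> = ((w x)\<^sup>2 * (h x)\<^sup>2 + (\<integral>y. P y x \<partial>unit_leb)) / 2"
      using yint(1,2)[of x] by (simp add: P1)
    finally show "(\<integral>y. k x y * w y * w x \<partial>unit_leb) \<le> ((w x)\<^sup>2 * (h x)\<^sup>2 + (\<integral>y. P y x \<partial>unit_leb)) / 2" .
  qed (use w2 swapint in auto)
  also have "\<dots> = (\<integral>x. (w x)\<^sup>2 * (h x)\<^sup>2 \<partial>unit_leb)"
    using w2 swapint swap by (simp add: P1)
  finally show ?thesis .
qed

text \<open>Duality: with g the function \<open>?g\<close>, test against the embedding of the
  density \<open>g / h\<^sup>2\<close>. The linear term is twice the integral of
  \<open>g\<^sup>2 / h\<^sup>2\<close>, and Schur's test bounds the subtracted square by that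
  integral once, leaving one copy.\<close>

lemma weighted_norm_comb_le:
  "(\<integral>x. (ker_comb ou_kernel a (c * x))\<^sup>2 / (h x)\<^sup>2 \<partial>unit_leb) \<le> ker_inner ou_kernel a a"
proof -
  let ?g = "\<lambda>x. ker_comb ou_kernel a (c * x)"
  have w: "continuous_on UNIV (\<lambda>x. ?g x / (h x)\<^sup>2)"
    by (intro continuous_intros continuous_on_ker_comb_ou h_cont) simp
  interpret K: kernel_embedding c "\<lambda>x. ?g x / (h x)\<^sup>2" using kernel_embedding[OF w] .
  show ?thesis using K.inner_ge_embed[of a] embed_sqnorm_le[OF w]
    by (simp add: power_divide power2_eq_square)
qed

text \<open>Passage from combinations to their limits. Since \<open>ou_kernel t t = 1\<close>, a
  bound on the norms is a uniform bound on the values, which gives dominated convergence.\<close>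

lemma weighted_norm_le:
  assumes f: "f \<in> rkhs ou_kernel" and cont: "continuous_on UNIV f"
  shows "(\<integral>x. (f (c * x))\<^sup>2 / (h x)\<^sup>2 \<partial>unit_leb) \<le> (rkhs_norm ou_kernel f)\<^sup>2"
proof -
  obtain A where A: "rkhs_represents ou_kernel A f" using f by (auto simp: rkhs_def)
  have norm: "(\<lambda>n. ker_norm ou_kernel (A n)) \<longlonglongrightarrow> rkhs_norm ou_kernel f"
    using ou.rkhs_norm_tendsto[OF A] .
  then obtain K where K: "\<And>n. ker_norm ou_kernel (A n) \<le> K" "K > 0"
    using convergent_imp_Bseq[of "\<lambda>n. ker_norm ou_kernel (A n)"] by (auto simp: convergent_def Bseq_def)
  have "(\<lambda>n. \<integral>x. (ker_comb ou_kernel (A n) (c * x))\<^sup>2 / (h x)\<^sup>2 \<partial>unit_leb)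
      \<longlonglongrightarrow> (\<integral>x. (f (c * x))\<^sup>2 / (h x)\<^sup>2 \<partial>unit_leb)"
  proof (rule integral_dominated_convergence[where w = "\<lambda>x. K\<^sup>2 / (h x)\<^sup>2"])
    show "(\<lambda>x. (f (c * x))\<^sup>2 / (h x)\<^sup>2) \<in> borel_measurable unit_leb"
      by (intro continuous_imp_unit_leb_measurable continuous_intros continuous_on_scaled cont h_cont) simp
    show "(\<lambda>x. (ker_comb ou_kernel (A n) (c * x))\<^sup>2 / (h x)\<^sup>2) \<in> borel_measurable unit_leb" for n
      by (intro continuous_imp_unit_leb_measurable continuous_intros continuous_on_ker_comb_ou h_cont) simp
    show "integrable unit_leb (\<lambda>x. K\<^sup>2 / (h x)\<^sup>2)"
      by (intro continuous_integrable_unit continuous_intros h_cont) simp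
    show "AE x in unit_leb. (\<lambda>n. (ker_comb ou_kernel (A n) (c * x))\<^sup>2 / (h x)\<^sup>2) \<longlonglongrightarrow> (f (c * x))\<^sup>2 / (h x)\<^sup>2"
      using A unfolding rkhs_represents_def by (intro AE_I2 tendsto_intros) auto
    show "AE x in unit_leb. norm ((ker_comb ou_kernel (A n) (c * x))\<^sup>2 / (h x)\<^sup>2) \<le> K\<^sup>2 / (h x)\<^sup>2" for n
    proof (rule AE_I2)
      fix x
      have "\<bar>ker_comb ou_kernel (A n) (c * x)\<bar> \<le> K"
        using ou.comb_le[of "A n" "c * x"] K(1)[of n] by simp
      then have "(ker_comb ou_kernel (A n) (c * x))\<^sup>2 \<le> K\<^sup>2" using K by (simp add: abs_le_square_iff[symmetric])
      then show "norm ((ker_comb ou_kernel (A n) (c * x))\<^sup>2 / (h x)\<^sup>2) \<le> K\<^sup>2 / (h x)\<^sup>2"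
        by (simp add: divide_right_mono)
    qed
  qed
  moreover have "(\<lambda>n. ker_inner ou_kernel (A n) (A n)) \<longlonglongrightarrow> (rkhs_norm ou_kernel f)\<^sup>2"
    using tendsto_power[OF norm, of 2] by (simp add: ou.norm_square)
  ultimately show ?thesis by (rule LIMSEQ_le) (use weighted_norm_comb_le in auto)
qed

definition V :: real where "V = 2 * (\<integral>x. ln (h x) \<partial>unit_leb)"

lemma ln_h_cont: "continuous_on UNIV (\<lambda>x. ln (h x))"
  using h_cont by (intro continuous_intros) auto

lemma ln_2h_integral: "(\<integral>x. ln (2 * (h x)\<^sup>2) \<partial>unit_leb) = ln 2 + V"
proof -
  have "ln (2 * (h x)\<^sup>2) = ln 2 + 2 * ln (h x)" for x
    using h_pos[of x] by (simp add: ln_mult ln_realpow)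
  then show ?thesis
    using continuous_integrable_unit[OF ln_h_cont] by (simp add: V_def unit_leb.prob_space[simplified])
qed

lemma continuous_on_h_rescaled: "continuous_on UNIV (\<lambda>s. h (s / c))"
  using continuous_on_scaled[OF h_cont, of "1 / c"] by simp

lemma J_func_le:
  assumes f: "continuous_on UNIV f" "continuous_on UNIV g"
  shows "J_func c f g \<le> ereal (ln 2 + V - 1 +
    ((\<integral>x. (f (c * x))\<^sup>2 / (h x)\<^sup>2 \<partial>unit_leb) + (\<integral>x. (g (c * x))\<^sup>2 / (h x)\<^sup>2 \<partial>unit_leb)) / 2)"
proof -
  \<comment> \<open>The point of tangency for the logarithm is the value of
    \<open>f\<^sup>2 + g\<^sup>2\<close> at the maximiser, so the bound is sharp there.\<close>
  define r where "r s = 2 * (h (s / c))\<^sup>2" for s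
  have r: "r s > 0" for s using h_pos[of "s / c"] by (simp add: r_def)
  define G where "G s = ln (r s) + ((f s)\<^sup>2 + (g s)\<^sup>2) / r s - 1" for s
  have r_cont: "continuous_on UNIV r" unfolding r_def by (intro continuous_intros continuous_on_h_rescaled)
  have rnz: "r s \<noteq> 0" for s using r[of s] by simp
  have G_cont: "continuous_on UNIV G"
    unfolding G_def by (intro continuous_intros r_cont f ballI rnz)
  have le: "ext_log ((f s)\<^sup>2 + (g s)\<^sup>2) \<le> ereal (G s)" for s
  proof (cases "(f s)\<^sup>2 + (g s)\<^sup>2 > 0")
    case True
    have "ln (((f s)\<^sup>2 + (g s)\<^sup>2) / r s) \<le> ((f s)\<^sup>2 + (g s)\<^sup>2) / r s - 1"
      using True r[of s] by (intro ln_le_minus_one) simp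
    then show ?thesis unfolding ln_divide_pos[OF True r] using True by (simp add: ext_log_def G_def)
  qed (simp add: ext_log_def)
  have "J_func c f g \<le> ereal (1 / c) * ereal_integral (restrict_space lborel {0..c}) (\<lambda>s. ereal (G s))"
    unfolding J_func_def using le c_pos by (intro ereal_mult_left_mono ereal_integral_mono_AE) auto
  also have "\<dots> = ereal (\<integral>x. G (c * x) \<partial>unit_leb)"
    using c_pos by (simp add: ereal_integral_ereal[OF integrable_rescale[OF c_pos G_cont]] integral_rescale[OF c_pos G_cont])
  also have "(\<integral>x. G (c * x) \<partial>unit_leb) = (\<integral>x. ln (2 * (h x)\<^sup>2) + ((f (c * x))\<^sup>2 / (h x)\<^sup>2 + (g (c * x))\<^sup>2 / (h x)\<^sup>2) / 2 - 1 \<partial>unit_leb)"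
    using c_pos by (simp add: G_def r_def add_divide_distrib mult.commute[of 2])
  also have "\<dots> = ln 2 + V - 1 +
    ((\<integral>x. (f (c * x))\<^sup>2 / (h x)\<^sup>2 \<partial>unit_leb) + (\<integral>x. (g (c * x))\<^sup>2 / (h x)\<^sup>2 \<partial>unit_leb)) / 2"
  proof -
    have i: "integrable unit_leb (\<lambda>x. (f (c * x))\<^sup>2 / (h x)\<^sup>2)" "integrable unit_leb (\<lambda>x. (g (c * x))\<^sup>2 / (h x)\<^sup>2)"
      "integrable unit_leb (\<lambda>x. ln (2 * (h x)\<^sup>2))"
      by (intro continuous_integrable_unit continuous_intros continuous_on_scaled f h_cont; simp)+
    then show ?thesis by (simp add: ln_2h_integral unit_leb.prob_space[simplified])
  qed
  finally show ?thesis .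
qed

lemma G_objective_le:
  assumes "p \<in> cont_fun_pairs" shows "G_objective c p \<le> ereal (ln 2 + V - 1)"
proof -
  obtain f g where p: "p = (f, g)" and f: "continuous_on UNIV f" "continuous_on UNIV g"
    using assms by (auto simp: cont_fun_pairs_def)
  note J = J_func_le[OF f]
  show ?thesis
  proof (cases "f \<in> rkhs ou_kernel \<and> g \<in> rkhs ou_kernel")
    case True
    note b = weighted_norm_le[of f] weighted_norm_le[of g]
    \<comment> \<open>The factor 1/2 of the quadratic terms in \<open>J_func_le\<close> is the one
      in \<open>I_rate\<close>, so the norms absorb them exactly.\<close>
    show ?thesis using True J b f
      by (cases "J_func c f g") (auto simp: G_objective_def p I_rate_def add_divide_distrib)
  next
    case False
    \<comment> \<open>One rate is infinite while \<open>J\<close> has a finite upper bound, so no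
      \<open>\<infinity> - \<infinity>\<close> arises and the objective is
      \<open>-\<infinity>\<close>.\<close>
    then show ?thesis using J by (cases "J_func c f g") (auto simp: G_objective_def p I_rate_def)
  qed
qed

text \<open>By the equation on the whole line, \<open>H\<close> is the embedding of the density
  \<open>1 / h\<close>; its squared norm is therefore the integral of \<open>h x / h x\<close>, that
  is 1.\<close>

lemma G_objective_attained:
  defines "H \<equiv> \<lambda>s. h (s / c)"
  shows "(H, H) \<in> cont_fun_pairs" "G_objective c (H, H) = ereal (ln 2 + V - 1)"
proof -
  have H: "continuous_on UNIV H" unfolding H_def by (rule continuous_on_h_rescaled)
  then show "(H, H) \<in> cont_fun_pairs" by (simp add: cont_fun_pairs_def)
  have w: "continuous_on UNIV (\<lambda>x. 1 / h x)" by (intro continuous_intros h_cont) simp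
  interpret K: kernel_embedding c "\<lambda>x. 1 / h x" using kernel_embedding[OF w] .
  have embed: "K.embed t = H t" for t
    unfolding K.embed_def H_def h_eq[of "t / c"] using c_pos by (simp add: ou_kernel_commute)
  then have embed_eq: "K.embed = H" by auto
  have "K.embed_sqnorm = 1" using c_pos by (simp add: K.embed_sqnorm_def embed H_def unit_leb.prob_space[simplified])
  then have I: "I_rate H = ereal (1 / 2)"
    using K.embed_rkhs K.rkhs_norm_embed by (simp add: I_rate_def embed_eq)
  have cont: "continuous_on UNIV (\<lambda>s. ln (2 * (H s)\<^sup>2))"
    by (intro continuous_intros H) (simp add: H_def)
  have "ext_log ((H s)\<^sup>2 + (H s)\<^sup>2) = ereal (ln (2 * (H s)\<^sup>2))" for s
    by (simp add: ext_log_def H_def)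
  then have "J_func c H H = ereal (\<integral>x. ln (2 * (H (c * x))\<^sup>2) \<partial>unit_leb)"
    using c_pos by (simp add: J_func_def ereal_integral_ereal[OF integrable_rescale[OF c_pos cont]] integral_rescale[OF c_pos cont])
  also have "\<dots> = ereal (ln 2 + V)" using c_pos by (simp add: H_def ln_2h_integral)
  finally show "G_objective c (H, H) = ereal (ln 2 + V - 1)" by (simp add: G_objective_def I)
qed

lemma V_G1_eq: "V_G1 c = ereal (ln 2 + V - 1)"
  unfolding V_G1_def using G_objective_le G_objective_attained
  by (intro antisym SUP_least) (auto intro: SUP_upper2)

end

subsection \<open>The copula problem\<close>

lemma nn_integral_leb_square:
  assumes F [measurable]: "F \<in> borel_measurable borel"
  shows "(\<integral>\<^sup>+p. F p \<partial>leb_square) = (\<integral>\<^sup>+x. \<integral>\<^sup>+y. F (x, y) \<partial>unit_leb \<partial>unit_leb)"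
    and "(\<integral>\<^sup>+p. F p \<partial>leb_square) = (\<integral>\<^sup>+y. \<integral>\<^sup>+x. F (x, y) \<partial>unit_leb \<partial>unit_leb)"
proof -
  let ?G = "\<lambda>p. F p * indicator unit_square p"
  have S: "unit_square \<in> sets borel" by (intro borel_closed closed_Times) auto
  have [measurable]: "?G \<in> borel_measurable (lborel \<Otimes>\<^sub>M lborel)"
    using S by (simp add: lborel_prod)
  have G: "?G (x, y) = F (x, y) * indicator {0..1} y * indicator {0..1} x" for x y
    by (auto simp: indicator_def)
  have [measurable]: "(\<lambda>y. F (x, y)) \<in> borel_measurable borel" "(\<lambda>x. F (x, y)) \<in> borel_measurable borel" for x y
    by (intro measurable_compose[OF _ F] borel_measurable_continuous_onI continuous_intros)+
  have 0: "(\<integral>\<^sup>+p. F p \<partial>leb_square) = (\<integral>\<^sup>+p. ?G p \<partial>(lborel \<Otimes>\<^sub>M lborel))"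
    using S by (simp add: leb_square_def nn_integral_restrict_space lborel_prod)
  also have "\<dots> = (\<integral>\<^sup>+x. \<integral>\<^sup>+y. ?G (x, y) \<partial>lborel \<partial>lborel)"
    by (rule lborel.nn_integral_fst[symmetric]) measurable
  also have "\<dots> = (\<integral>\<^sup>+x. \<integral>\<^sup>+y. F (x, y) \<partial>unit_leb \<partial>unit_leb)"
    by (simp add: G nn_integral_restrict_space nn_integral_multc)
  finally show "(\<integral>\<^sup>+p. F p \<partial>leb_square) = (\<integral>\<^sup>+x. \<integral>\<^sup>+y. F (x, y) \<partial>unit_leb \<partial>unit_leb)" .
  note 0
  also have "(\<integral>\<^sup>+p. ?G p \<partial>(lborel \<Otimes>\<^sub>M lborel)) = (\<integral>\<^sup>+y. \<integral>\<^sup>+x. ?G (x, y) \<partial>lborel \<partial>lborel)"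
    by (rule lborel_pair.nn_integral_snd[symmetric]) measurable
  also have "\<dots> = (\<integral>\<^sup>+y. \<integral>\<^sup>+x. F (x, y) * indicator {0..1} x * indicator {0..1} y \<partial>lborel \<partial>lborel)"
    by (simp add: G mult_ac)
  also have "\<dots> = (\<integral>\<^sup>+y. \<integral>\<^sup>+x. F (x, y) \<partial>unit_leb \<partial>unit_leb)"
    by (simp add: nn_integral_restrict_space nn_integral_multc)
  finally show "(\<integral>\<^sup>+p. F p \<partial>leb_square) = (\<integral>\<^sup>+y. \<integral>\<^sup>+x. F (x, y) \<partial>unit_leb \<partial>unit_leb)" .
qed

lemma integral_uniform_unit:
  fixes f :: "real \<Rightarrow> real" assumes [measurable]: "f \<in> borel_measurable borel"
  shows "(\<integral>x. f x \<partial>uniform_measure lborel {0..1}) = (\<integral>x. f x \<partial>unit_leb)"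
proof -
  have "uniform_measure lborel {0..1::real} = density lborel (\<lambda>x. ennreal (indicator {0..1} x))"
    by (simp add: uniform_measure_def ennreal_indicator divide_ennreal_def)
  then show ?thesis by (simp add: integral_density integral_restrict_space)
qed

lemma emeasure_uniform_unit:
  assumes "A \<in> sets borel"
  shows "emeasure (uniform_measure lborel {0..1::real}) A = (\<integral>\<^sup>+x. indicator A x \<partial>unit_leb)"
proof -
  have "(\<integral>\<^sup>+x. indicator A x \<partial>unit_leb) = (\<integral>\<^sup>+x. indicator ({0..1} \<inter> A) x \<partial>lborel)"
    by (auto simp: nn_integral_restrict_space indicator_def intro!: nn_integral_cong)
  also have "\<dots> = emeasure lborel ({0..1} \<inter> A)"
    using assms by (intro nn_integral_indicator) auto
  finally show ?thesis using assms by (simp add: divide_ennreal_def)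
qed

lemma sets_leb_square: "sets leb_square = sets (restrict_space borel unit_square)"
  unfolding leb_square_def by (rule sets_restrict_space_cong) simp

lemma borel_measurable_leb_square:
  assumes "sets M = sets (restrict_space borel unit_square)" "f \<in> borel_measurable borel"
  shows "f \<in> borel_measurable M"
  using measurable_restrict_space1[OF assms(2)] measurable_cong_sets[OF assms(1) refl] by blast

context schroedinger
begin

definition dens :: "real \<times> real \<Rightarrow> real" where
  "dens p = ou_kernel (c * fst p) (c * snd p) / (h (fst p) * h (snd p))"

definition opt :: "(real \<times> real) measure" where
  "opt = density leb_square (\<lambda>p. ennreal (dens p))"

lemma dens_pos: "dens p > 0"
  by (simp add: dens_def h_pos)

lemma dens_measurable [measurable]: "dens \<in> borel_measurable borel"
proof -
  have "continuous_on UNIV (\<lambda>p. h (fst p))" "continuous_on UNIV (\<lambda>p. h (snd p))"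
    by (rule continuous_on_compose2[OF h_cont]; auto intro!: continuous_intros)+
  then have "continuous_on UNIV dens"
    unfolding dens_def[abs_def] by (intro continuous_intros) auto
  then show ?thesis by (rule borel_measurable_continuous_onI)
qed

lemma dens_measurable' [measurable]: "dens \<in> borel_measurable leb_square"
  using sets_leb_square dens_measurable by (rule borel_measurable_leb_square)

text \<open>The equation for \<open>h\<close>, divided by \<open>h x\<close>; symmetry of the kernel
  gives the other coordinate.\<close>

lemma nn_integral_dens:
  "(\<integral>\<^sup>+y. ennreal (dens (x, y)) \<partial>unit_leb) = 1" "(\<integral>\<^sup>+y. ennreal (dens (y, x)) \<partial>unit_leb) = 1"
proof -
  have cont: "continuous_on UNIV (\<lambda>y. dens (x, y))"
    unfolding dens_def by (auto intro!: continuous_intros h_cont)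
  have "(\<integral>\<^sup>+y. ennreal (dens (x, y)) \<partial>unit_leb) = ennreal (\<integral>y. dens (x, y) \<partial>unit_leb)"
    by (intro nn_integral_eq_integral continuous_integrable_unit cont) (simp add: less_imp_le dens_pos)
  also have "(\<integral>y. dens (x, y) \<partial>unit_leb) = (\<integral>y. ou_kernel (c * x) (c * y) / h y / h x \<partial>unit_leb)"
    by (simp add: dens_def mult.commute)
  also have "\<dots> = h x / h x" unfolding integral_divide_zero h_eq[of x, symmetric] ..
  finally show 1: "(\<integral>\<^sup>+y. ennreal (dens (x, y)) \<partial>unit_leb) = 1" by simp
  have "dens (y, x) = dens (x, y)" for y by (simp add: dens_def ou_kernel_commute mult.commute)
  then show "(\<integral>\<^sup>+y. ennreal (dens (y, x)) \<partial>unit_leb) = 1" using 1 by simp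
qed

lemma nn_integral_dens_square: "(\<integral>\<^sup>+p. ennreal (dens p) \<partial>leb_square) = 1"
  by (simp add: nn_integral_leb_square(1) nn_integral_dens unit_leb.emeasure_space_1[simplified])

lemma opt_marginal:
  "distr opt borel fst = uniform_measure lborel {0..1}" "distr opt borel snd = uniform_measure lborel {0..1}"
proof -
  have opt: "emeasure (distr opt borel f) A = (\<integral>\<^sup>+p. ennreal (dens p) * indicator A (f p) \<partial>leb_square)"
    if f: "f \<in> borel_measurable borel" and A: "A \<in> sets borel" for f :: "real \<times> real \<Rightarrow> real" and A
  proof -
    have f' [measurable]: "f \<in> borel_measurable leb_square"
      using sets_leb_square f by (rule borel_measurable_leb_square)
    have "emeasure (distr opt borel f) A = emeasure opt (f -` A \<inter> space leb_square)"
      using f' A by (subst emeasure_distr) (auto simp: opt_def)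
    also have "\<dots> = (\<integral>\<^sup>+p. ennreal (dens p) * indicator (f -` A \<inter> space leb_square) p \<partial>leb_square)"
      unfolding opt_def using measurable_sets[OF f' A] by (intro emeasure_density) auto
    also have "\<dots> = (\<integral>\<^sup>+p. ennreal (dens p) * indicator A (f p) \<partial>leb_square)"
      by (intro nn_integral_cong) (auto simp: indicator_def)
    finally show ?thesis .
  qed
  have [measurable]: "(fst :: real \<times> real \<Rightarrow> real) \<in> borel_measurable borel" "(snd :: real \<times> real \<Rightarrow> real) \<in> borel_measurable borel"
    by (intro borel_measurable_continuous_onI continuous_intros)+
  have sec [measurable]: "(\<lambda>y. dens (x, y)) \<in> borel_measurable unit_leb" "(\<lambda>y. dens (y, x)) \<in> borel_measurable unit_leb" for x
    by (intro borel_measurable_unit_leb measurable_compose[OF _ dens_measurable] borel_measurable_continuous_onI continuous_intros)+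
  show "distr opt borel fst = uniform_measure lborel {0..1}"
  proof (rule measure_eqI)
    fix A :: "real set" assume "A \<in> sets (distr opt borel fst)"
    then have A [measurable]: "A \<in> sets borel" by simp
    have "emeasure (distr opt borel fst) A = (\<integral>\<^sup>+x. \<integral>\<^sup>+y. ennreal (dens (x, y)) * indicator A x \<partial>unit_leb \<partial>unit_leb)"
      by (subst opt) (auto simp: nn_integral_leb_square(1))
    then show "emeasure (distr opt borel fst) A = emeasure (uniform_measure lborel {0..1}) A"
      by (simp add: nn_integral_multc nn_integral_dens emeasure_uniform_unit del: emeasure_uniform_measure)
  qed simp
  show "distr opt borel snd = uniform_measure lborel {0..1}"
  proof (rule measure_eqI)
    fix A :: "real set" assume "A \<in> sets (distr opt borel snd)"
    then have A [measurable]: "A \<in> sets borel" by simp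
    have "emeasure (distr opt borel snd) A = (\<integral>\<^sup>+y. \<integral>\<^sup>+x. ennreal (dens (x, y)) * indicator A y \<partial>unit_leb \<partial>unit_leb)"
      by (subst opt) (auto simp: nn_integral_leb_square(2))
    then show "emeasure (distr opt borel snd) A = emeasure (uniform_measure lborel {0..1}) A"
      by (simp add: nn_integral_multc nn_integral_dens emeasure_uniform_unit del: emeasure_uniform_measure)
  qed simp
qed

lemma opt_copula: "opt \<in> copulas"
proof -
  have "prob_space opt"
    using nn_integral_dens_square by (intro prob_spaceI) (simp add: opt_def emeasure_density cong: nn_integral_cong_simp)
  then show ?thesis using opt_marginal by (simp add: copulas_def opt_def sets_leb_square)
qed

text \<open>The logarithm of \<open>dens\<close> splits into \<open>- c * |x - y|\<close> and two
  functions of one coordinate each. The latter see only the marginals, so they contribute the same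
  constant \<open>- V\<close> for every copula.\<close>

lemma
  assumes M: "M \<in> copulas"
  shows integrable_ln_dens: "integrable M (\<lambda>p. ln (dens p))"
    and integral_ln_dens: "(\<integral>p. ln (dens p) \<partial>M) = - c * (\<integral>(x, y). \<bar>x - y\<bar> \<partial>M) - V"
proof -
  have sets: "sets M = sets (restrict_space borel unit_square)"
    and marg: "distr M borel fst = uniform_measure lborel {0..1}" "distr M borel snd = uniform_measure lborel {0..1}"
    using M by (auto simp: copulas_def)
  interpret prob_space M using M by (simp add: copulas_def)
  have space: "space M = unit_square" using sets_eq_imp_space_eq[OF sets] by (simp add: space_restrict_space)
  have [measurable]: "fst \<in> borel_measurable M" "snd \<in> borel_measurable M"
    by (rule borel_measurable_leb_square[OF sets], intro borel_measurable_continuous_onI continuous_intros)+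
  have lnh [measurable]: "(\<lambda>x. ln (h x)) \<in> borel_measurable borel" by measurable
  obtain B where B: "\<And>x. x \<in> {0..1} \<Longrightarrow> \<bar>ln (h x)\<bar> \<le> B"
    using continuous_bounded_unit[OF ln_h_cont] by blast
  have i: "integrable M (\<lambda>p. \<bar>fst p - snd p\<bar>)" "integrable M (\<lambda>p. ln (h (fst p)))" "integrable M (\<lambda>p. ln (h (snd p)))"
  proof -
    show "integrable M (\<lambda>p. \<bar>fst p - snd p\<bar>)"
      by (rule integrable_const_bound[of _ 1]) (auto intro!: AE_I2 simp: space)
    show "integrable M (\<lambda>p. ln (h (fst p)))" "integrable M (\<lambda>p. ln (h (snd p)))"
      by (rule integrable_const_bound[of _ B]; auto intro!: AE_I2 B simp: space)+
  qed
  have eq: "ln (dens p) = - c * \<bar>fst p - snd p\<bar> - ln (h (fst p)) - ln (h (snd p))" for p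
    using h_pos[of "fst p"] h_pos[of "snd p"] c_pos
    by (simp add: dens_def ln_div ln_mult ou_kernel_def abs_mult flip: right_diff_distrib)
  show "integrable M (\<lambda>p. ln (dens p))" unfolding eq using i by auto
  have "(\<integral>p. ln (h (fst p)) \<partial>M) = (\<integral>x. ln (h x) \<partial>unit_leb)"
    using integral_distr[of fst M borel "\<lambda>x. ln (h x)"] lnh
    by (simp add: marg integral_uniform_unit)
  moreover have "(\<integral>p. ln (h (snd p)) \<partial>M) = (\<integral>x. ln (h x) \<partial>unit_leb)"
    using integral_distr[of snd M borel "\<lambda>x. ln (h x)"] lnh
    by (simp add: marg integral_uniform_unit)
  ultimately show "(\<integral>p. ln (dens p) \<partial>M) = - c * (\<integral>(x, y). \<bar>x - y\<bar> \<partial>M) - V"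
    unfolding eq using i by (simp add: V_def split_beta')
qed

lemma sigma_finite_leb_square: "sigma_finite_measure leb_square"
  unfolding leb_square_def
  by (rule sigma_finite_measure_restrict_space[OF sigma_finite_lborel]) (auto intro!: borel_closed closed_Times)

text \<open>Gibbs' inequality, in the form \<open>ln r \<ge> ln g + 1 - g / r\<close> for the densities \<open>r\<close> of \<open>M\<close> and \<open>g\<close> of \<open>opt\<close>.\<close>

lemma KL_div_ge:
  assumes M: "M \<in> copulas" shows "ereal (\<integral>p. ln (dens p) \<partial>M) \<le> KL_div M leb_square"
proof (cases "absolutely_continuous leb_square M")
  case True
  have sets: "sets M = sets (restrict_space borel unit_square)" using M by (auto simp: copulas_def)
  interpret prob_space M using M by (simp add: copulas_def)
  interpret L: sigma_finite_measure leb_square by (rule sigma_finite_leb_square)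
  have [measurable]: "dens \<in> borel_measurable M"
    using sets dens_measurable by (rule borel_measurable_leb_square)
  define \<rho> where "\<rho> = RN_deriv leb_square M"
  have sets': "sets M = sets leb_square" using sets sets_leb_square by simp
  have \<rho> [measurable]: "\<rho> \<in> borel_measurable leb_square" by (simp add: \<rho>_def)
  have \<rho>M [measurable]: "\<rho> \<in> borel_measurable M" using \<rho> measurable_cong_sets[OF sets' refl] by blast
  have M_eq: "density leb_square \<rho> = M" unfolding \<rho>_def by (rule L.density_RN_deriv[OF True sets'])
  have fin: "AE p in leb_square. \<rho> p \<noteq> \<infinity>"
    unfolding \<rho>_def by (rule L.RN_deriv_finite[OF sigma_finite_measure_axioms True sets'])
  define r where "r p = enn2real (\<rho> p)" for p
  have r_pos: "AE p in M. r p > 0"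
    unfolding M_eq[symmetric] using fin
    by (subst AE_density) (auto simp: r_def enn2real_positive_iff less_top elim: eventually_mono)
  have [measurable]: "r \<in> borel_measurable M" unfolding r_def by measurable
  have [measurable]: "r \<in> borel_measurable leb_square" unfolding r_def by measurable
  have r_nonneg: "r p \<ge> 0" for p by (simp add: r_def)
  \<comment> \<open>Changing to Lebesgue measure cancels \<open>r\<close> where it is positive.
    Where \<open>r p = 0\<close> the integrand is 0, so in general only an inequality with the total
    mass of \<open>opt\<close> remains.\<close>
  have "(\<integral>\<^sup>+p. ennreal (dens p / r p) \<partial>M) = (\<integral>\<^sup>+p. \<rho> p * ennreal (dens p / r p) \<partial>leb_square)"
    by (subst M_eq[symmetric], subst nn_integral_density) auto
  also have "\<dots> \<le> (\<integral>\<^sup>+p. ennreal (dens p) \<partial>leb_square)"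
  proof (rule nn_integral_mono_AE)
    show "AE p in leb_square. \<rho> p * ennreal (dens p / r p) \<le> ennreal (dens p)"
      using fin
    proof eventually_elim
      case (elim p)
      then have "\<rho> p = ennreal (r p)" by (simp add: r_def less_top)
      then show ?case
        using dens_pos[of p] r_nonneg[of p] by (cases "r p = 0") (simp_all add: ennreal_mult[symmetric])
    qed
  qed
  finally have le1: "(\<integral>\<^sup>+p. ennreal (dens p / r p) \<partial>M) \<le> 1" by (simp add: nn_integral_dens_square)
  have nonneg: "dens p / r p \<ge> 0" for p using dens_pos[of p] r_nonneg[of p] by simp
  have int: "integrable M (\<lambda>p. dens p / r p)"
    using le1 nonneg by (intro integrableI_nonneg) (auto simp: le_less_trans)
  then have int_le1: "(\<integral>p. dens p / r p \<partial>M) \<le> 1"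
    using le1 nn_integral_eq_integral[OF int] nonneg by simp
  have int_ln: "integrable M (\<lambda>p. ln (dens p))" by (rule integrable_ln_dens[OF M])
  \<comment> \<open>The added term \<open>1 - dens p / r p\<close> has nonnegative integral by
    \<open>int_le1\<close>.\<close>
  have "(\<integral>p. ln (dens p) \<partial>M) \<le> (\<integral>p. ln (dens p) + 1 - dens p / r p \<partial>M)"
    using int int_ln int_le1 by (simp add: prob_space)
  also have "ereal \<dots> = ereal_integral M (\<lambda>p. ereal (ln (dens p) + 1 - dens p / r p))"
    using int int_ln by (intro ereal_integral_ereal[symmetric]) auto
  also have "\<dots> \<le> ereal_integral M (\<lambda>p. ereal (entropy_density (exp 1) leb_square M p))"
  proof (rule ereal_integral_mono_AE)
    show "AE p in M. ereal (ln (dens p) + 1 - dens p / r p) \<le> ereal (entropy_density (exp 1) leb_square M p)"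
      using r_pos
    proof eventually_elim
      case (elim p)
      have "ln (dens p / r p) \<le> dens p / r p - 1" using elim dens_pos[of p] by (intro ln_le_minus_one) simp
      then show ?case unfolding ln_divide_pos[OF dens_pos elim]
        by (simp add: entropy_density_def r_def \<rho>_def flip: log_ln)
    qed
  qed
  finally show ?thesis using True by (simp add: KL_div_def)
qed (simp add: KL_div_def)

lemma KL_div_opt: "KL_div opt leb_square = ereal (\<integral>p. ln (dens p) \<partial>opt)"
proof -
  interpret L: sigma_finite_measure leb_square by (rule sigma_finite_leb_square)
  have ac: "absolutely_continuous leb_square opt"
    unfolding opt_def by (rule absolutely_continuousI_density) measurable
  have "AE p in leb_square. ennreal (dens p) = RN_deriv leb_square opt p"
    by (rule L.RN_deriv_unique) (simp_all add: opt_def)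
  \<comment> \<open>Uniqueness of the density holds up to Lebesgue null sets; absolute continuity
    carries it over to \<open>opt\<close>.\<close>
  then have "AE p in opt. ennreal (dens p) = RN_deriv leb_square opt p"
    by (intro absolutely_continuous_AE[OF _ ac]) (simp_all add: opt_def)
  then have "AE p in opt. ereal (entropy_density (exp 1) leb_square opt p) = ereal (ln (dens p))"
    by eventually_elim (simp add: entropy_density_def less_imp_le dens_pos flip: log_ln, metis enn2real_ennreal dens_pos less_imp_le)
  from ereal_integral_cong_AE[OF this] show ?thesis
    using ac ereal_integral_ereal[OF integrable_ln_dens[OF opt_copula]] by (simp add: KL_div_def)
qed

text \<open>By \<open>integral_ln_dens\<close> the objective is \<open>V\<close> plus the integral
  of \<open>ln (dens p)\<close> minus the divergence, and Gibbs' inequality makes the difference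
  nonpositive.\<close>

lemma P_objective_le:
  assumes "M \<in> copulas" shows "P_objective c M \<le> ereal V"
  using KL_div_ge[OF assms] integral_ln_dens[OF assms]
  unfolding P_objective_def by (cases "KL_div M leb_square") auto

lemma P_objective_opt: "P_objective c opt = ereal V"
  by (simp add: P_objective_def KL_div_opt integral_ln_dens[OF opt_copula])

lemma V_P_eq: "V_P c = ereal V"
  unfolding V_P_def
proof (rule antisym)
  show "(SUP M\<in>copulas. P_objective c M) \<le> ereal V" by (rule SUP_least) (rule P_objective_le)
  show "ereal V \<le> (SUP M\<in>copulas. P_objective c M)"
    using opt_copula by (rule SUP_upper2) (simp add: P_objective_opt)
qed

end

text \<open>\<open>V_P\<close> and \<open>V_G1\<close> are defined as suprema; the first two
  conjuncts state that they are maximal values.\<close>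

theorem proposition1p18:
  fixes c :: real
  assumes "c > 0"
  shows "(\<exists>M\<in>copulas. P_objective c M = V_P c) \<and>
         (\<exists>f\<in>cont_fun_pairs. G_objective c f = V_G1 c) \<and>
         V_P c = V_G1 c - ereal (ln 2) + 1"
proof -
  obtain h where "schroedinger c h" using exists_schroedinger[OF assms] ..
  then interpret schroedinger c h .
  show ?thesis
  proof (intro conjI bexI)
    show "P_objective c opt = V_P c" by (simp add: P_objective_opt V_P_eq)
    show "G_objective c (\<lambda>s. h (s / c), \<lambda>s. h (s / c)) = V_G1 c"
      by (simp only: G_objective_attained V_G1_eq)
    show "V_P c = V_G1 c - ereal (ln 2) + 1" by (simp add: V_P_eq V_G1_eq one_ereal_def)
  qed (fact opt_copula G_objective_attained(1))+
qed

end
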